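(* Let $A\in\mathscr{H}$ be of finite order $n\neq2$. Then $A$ is conjugate in $\mathscr{H}$ to a rotation $$R_\theta=\begin{bmatrix}1&0\\0&e^{\mathbf{i}\theta}\end{bmatrix}$$ for some angle $\theta$.
   Context: $S\subset\mathbb{P}^3_{\mathbb{R}}$ is the real projective surface $w^2=x^2+y^2+z^2$, and $\pi\colon S\dashrightarrow\mathbb{P}^1$ is $(w:x:y:z)\mapsto(w:z)$. $\mathrm{Aut}(S(\mathbb{R})/\pi)$ is the group of birational maps $g\colon S\dashrightarrow S$ defined over $\mathbb{R}$ with $\pi g=\pi$ and such that $g,g^{-1}$ are defined at every real point of $S$. Let $\psi\colon S_{\mathbb{C}}\dashrightarrow\mathbb{A}^2_{\mathbb{C}}$ be the birational map $(x,y,z)\mapsto(x-\mathbf{i}y,z)$ (chart $w=1$). The group $\mathrm{PGL}(2,\mathbb{C}(z))$ acts on $\mathbb{A}^2_{\mathbb{C}}$ birationally by $\left[\begin{smallmatrix}\alpha&\beta\\\gamma&\delta\end{smallmatrix}\right]\colon(t,z)\mapsto\left(\frac{\alpha t+\beta}{\gamma t+\delta},z\right)$. Then $\mathscr{H}:=\psi\,\mathrm{Aut}(S(\mathbb{R})/\pi)\,\psi^{-1}\subset\mathrm{PGL}(2,\mathbb{C}(z))$. The element $R_\theta$ corresponds to the rotation $(x,y,z)\mapsto(x\cos\theta-y\sin\theta,x\sin\theta+y\cos\theta,z)$ of $S$. *)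

theory Defs
  imports
    "HOL-Analysis.Analysis"
    "HOL-Library.Poly_Mapping"
    "HOL-Computational_Algebra.Polynomial"
    "HOL-Computational_Algebra.Fraction_Field"
    "HOL-Algebra.Multiplicative_Group"
begin

text \<open>Names of the homogeneous coordinates (w : x : y : z) of projective 3-space.\<close>

datatype coord = Cw | Cx | Cy | Cz

type_synonym rpoly = "(coord \<Rightarrow>\<^sub>0 nat) \<Rightarrow>\<^sub>0 real"

definition Var :: "coord \<Rightarrow> rpoly" where
  "Var i = Poly_Mapping.single (Poly_Mapping.single i 1) 1"

definition homogeneous :: "nat \<Rightarrow> rpoly \<Rightarrow> bool" where
  "homogeneous d p \<longleftrightarrow>
     (\<forall>m\<in>Poly_Mapping.keys p. (\<Sum>i\<in>Poly_Mapping.keys m. Poly_Mapping.lookup m i) = d)"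

text \<open>Evaluation at a point over any real algebra; \<open>\<phi>\<close> is the structure map of that algebra.\<close>

definition ev :: "(real \<Rightarrow> 'b::comm_ring_1) \<Rightarrow> (coord \<Rightarrow> 'b) \<Rightarrow> rpoly \<Rightarrow> 'b" where
  "ev \<phi> v p = (\<Sum>m\<in>Poly_Mapping.keys p.
      \<phi> (Poly_Mapping.lookup p m) * (\<Prod>i\<in>Poly_Mapping.keys m. v i ^ Poly_Mapping.lookup m i))"

text \<open>Homogeneous coordinate vectors of the points of S over a field.\<close>

definition S_points :: "(coord \<Rightarrow> 'a::field) set" where
  "S_points = {v. (\<exists>i. v i \<noteq> 0) \<and> (v Cw)\<^sup>2 = (v Cx)\<^sup>2 + (v Cy)\<^sup>2 + (v Cz)\<^sup>2}"

text \<open>A rational map, defined over the reals, from S to the projective space with homogeneous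
  coordinates indexed by I is given by a family of real forms of one common degree, not all
  vanishing identically on the complex points of S. Two families give the same rational map iff
  they are proportional at every complex point of S. (S is irreducible, and its ideal consists of
  the polynomials vanishing on its complex points.) Entries of a family outside I are irrelevant.\<close>

definition rational_map :: "coord set \<Rightarrow> (coord \<Rightarrow> rpoly) \<Rightarrow> bool" where
  "rational_map I F \<longleftrightarrow> (\<exists>d. \<forall>i\<in>I. homogeneous d (F i)) \<and>
     (\<exists>v\<in>S_points. \<exists>i\<in>I. ev complex_of_real v (F i) \<noteq> 0)"

definition same_map :: "coord set \<Rightarrow> (coord \<Rightarrow> rpoly) \<Rightarrow> (coord \<Rightarrow> rpoly) \<Rightarrow> bool" where
  "same_map I F G \<longleftrightarrow> (\<forall>v\<in>S_points. \<forall>i\<in>I. \<forall>j\<in>I.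
     ev complex_of_real v (F i) * ev complex_of_real v (G j) =
     ev complex_of_real v (F j) * ev complex_of_real v (G i))"

definition rational_selfmap :: "(coord \<Rightarrow> rpoly) \<Rightarrow> bool" where
  "rational_selfmap F \<longleftrightarrow> rational_map UNIV F \<and>
     (\<forall>v\<in>S_points. (\<exists>i. ev complex_of_real v (F i) \<noteq> 0) \<longrightarrow>
        (\<lambda>i. ev complex_of_real v (F i)) \<in> S_points)"

definition comp_map :: "(coord \<Rightarrow> rpoly) \<Rightarrow> (coord \<Rightarrow> rpoly) \<Rightarrow> coord \<Rightarrow> rpoly" where
  "comp_map F G = (\<lambda>i. ev (Poly_Mapping.single 0) G (F i))"

text \<open>The family \<open>Var\<close> represents the identity.\<close>

definition inverse_maps :: "(coord \<Rightarrow> rpoly) \<Rightarrow> (coord \<Rightarrow> rpoly) \<Rightarrow> bool" where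
  "inverse_maps F G \<longleftrightarrow>
     rational_map UNIV (comp_map F G) \<and> same_map UNIV (comp_map F G) Var \<and>
     rational_map UNIV (comp_map G F) \<and> same_map UNIV (comp_map G F) Var"

text \<open>A rational map is defined at a point iff some family representing it does not vanish there.\<close>

definition defined_at :: "(coord \<Rightarrow> rpoly) \<Rightarrow> (coord \<Rightarrow> real) \<Rightarrow> bool" where
  "defined_at F v \<longleftrightarrow>
     (\<exists>F'. rational_map UNIV F' \<and> same_map UNIV F' F \<and> (\<exists>i. ev id v (F' i) \<noteq> 0))"

text \<open>The projection \<open>\<pi>\<close>, (w : x : y : z) to (w : z), is the family \<open>Var\<close> with index set
  \<open>{Cw, Cz}\<close>, and \<open>\<pi>\<close> composed with F is F with that index set.\<close>

definition preserves_pi :: "(coord \<Rightarrow> rpoly) \<Rightarrow> bool" where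
  "preserves_pi F \<longleftrightarrow> rational_map {Cw, Cz} F \<and> same_map {Cw, Cz} F Var"

text \<open>The elements of Aut(S(R)/\<open>\<pi>\<close>), each given by all the families representing it.\<close>

definition Aut_S_pi :: "(coord \<Rightarrow> rpoly) set" where
  "Aut_S_pi = {F. rational_selfmap F \<and> preserves_pi F \<and>
     (\<exists>G. rational_selfmap G \<and> inverse_maps F G \<and>
          (\<forall>v\<in>S_points. defined_at F v \<and> defined_at G v))}"


definition GL2 :: "('a::field^2^2) monoid" where
  "GL2 = \<lparr>carrier = {M. invertible M}, monoid.mult = (**), one = mat 1\<rparr>"

definition scalars2 :: "('a::field^2^2) set" where
  "scalars2 = {mat c | c. c \<noteq> 0}"

definition PGL2 :: "('a::field^2^2) set monoid" where
  "PGL2 = GL2 Mod scalars2"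

definition pgl_class :: "'a::field \<Rightarrow> 'a \<Rightarrow> 'a \<Rightarrow> 'a \<Rightarrow> ('a^2^2) set" where
  "pgl_class a b c d = scalars2 #>\<^bsub>GL2\<^esub> vector [vector [a, b], vector [c, d]]"

lemma group_GL2: "group (GL2 :: ('a::field^2^2) monoid)"
proof (rule groupI)
  fix M :: "'a^2^2" assume "M \<in> carrier GL2"
  then obtain N where "M ** N = mat 1" "N ** M = mat 1"
    by (auto simp: GL2_def invertible_def)
  then show "\<exists>N\<in>carrier GL2. N \<otimes>\<^bsub>GL2\<^esub> M = \<one>\<^bsub>GL2\<^esub>"
    by (auto simp: GL2_def invertible_def)
qed (auto simp: GL2_def invertible_mult matrix_mul_assoc invertible_def[of "mat 1"])

lemma mat_mult_mat: "(mat c :: 'a::field^2^2) ** mat d = mat (c * d)"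
  by (simp add: vec_eq_iff matrix_matrix_mult_def mat_def sum_2 forall_2)

lemma mat_mult_commute: "(mat c :: 'a::field^2^2) ** M = M ** mat c"
  by (simp add: vec_eq_iff matrix_matrix_mult_def mat_def if_distrib[of "\<lambda>x. x * _"]
      if_distrib[of "\<lambda>x. _ * x"] mult.commute cong: if_cong)

lemma mat_invertible: "c \<noteq> 0 \<Longrightarrow> invertible (mat c :: 'a::field^2^2)"
  by (auto simp: invertible_def mat_mult_mat intro!: exI[of _ "mat (inverse c)"])

lemma normal_scalars2: "(scalars2 :: ('a::field^2^2) set) \<lhd> GL2"
proof -
  interpret group "GL2 :: ('a^2^2) monoid" by (rule group_GL2)
  have inv: "inv\<^bsub>GL2\<^esub> (mat c :: 'a^2^2) = mat (inverse c)" if "c \<noteq> 0" for c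
    by (rule inv_equality) (use that in \<open>auto simp: GL2_def mat_mult_mat mat_invertible\<close>)
  have "subgroup (scalars2 :: ('a^2^2) set) GL2"
  proof
    fix M :: "'a^2^2" assume "M \<in> scalars2"
    then show "inv\<^bsub>GL2\<^esub> M \<in> scalars2"
      by (auto simp: scalars2_def inv)
  next
    fix M N :: "'a^2^2" assume "M \<in> scalars2" "N \<in> scalars2"
    then show "M \<otimes>\<^bsub>GL2\<^esub> N \<in> scalars2"
      by (auto simp: scalars2_def GL2_def mat_mult_mat)
  qed (auto simp: GL2_def scalars2_def mat_invertible intro!: exI[of _ 1])
  then show ?thesis
  proof (rule normal_invI)
    fix M N :: "'a^2^2" assume M: "M \<in> carrier GL2" and N: "N \<in> scalars2"
    then obtain c where c: "N = mat c" "c \<noteq> 0" by (auto simp: scalars2_def)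
    have "M \<otimes>\<^bsub>GL2\<^esub> N = N \<otimes>\<^bsub>GL2\<^esub> M"
      by (simp add: GL2_def c mat_mult_commute)
    moreover have "N \<in> carrier GL2" by (simp add: GL2_def c mat_invertible)
    ultimately have "M \<otimes>\<^bsub>GL2\<^esub> N \<otimes>\<^bsub>GL2\<^esub> inv\<^bsub>GL2\<^esub> M = N"
      using M by (simp add: m_assoc)
    then show "M \<otimes>\<^bsub>GL2\<^esub> N \<otimes>\<^bsub>GL2\<^esub> inv\<^bsub>GL2\<^esub> M \<in> scalars2"
      using N by simp
  qed
qed

lemma group_PGL2: "group (PGL2 :: ('a::field^2^2) set monoid)"
  unfolding PGL2_def by (intro normal.factorgroup_is_group normal_scalars2)


text \<open>C(z), and the function field C(z)(t) of the affine plane with coordinates (t, z). A rational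
  map between affine varieties is identified with its value at the generic point (t, z).\<close>

type_synonym Cz_field = "complex poly fract"
type_synonym K_field = "complex poly fract poly fract"

definition Cz_const :: "complex \<Rightarrow> Cz_field" where
  "Cz_const c = Fraction_Field.Fract [:c:] 1"

definition Cz_embed :: "Cz_field \<Rightarrow> K_field" where
  "Cz_embed a = Fraction_Field.Fract [:a:] 1"

definition K_const :: "complex \<Rightarrow> K_field" where
  "K_const c = Cz_embed (Cz_const c)"

definition gen_t :: K_field where
  "gen_t = Fraction_Field.Fract [:0, 1:] 1"

definition gen_z :: K_field where
  "gen_z = Cz_embed (Fraction_Field.Fract [:0, 1:] 1)"

definition psi :: "(coord \<Rightarrow> K_field) \<Rightarrow> K_field \<times> K_field" where
  "psi v = (v Cx / v Cw - K_const \<i> * (v Cy / v Cw), v Cz / v Cw)"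

text \<open>On S one has (x - iy)(x + iy) = 1 - z\<open>\<^sup>2\<close> in the chart w = 1; this gives the inverse of psi.\<close>

definition psi_inv :: "K_field \<times> K_field \<Rightarrow> coord \<Rightarrow> K_field" where
  "psi_inv = (\<lambda>(t, z) i. case i of
       Cw \<Rightarrow> 1
     | Cx \<Rightarrow> K_const (1/2) * (t + (1 - z\<^sup>2) / t)
     | Cy \<Rightarrow> K_const (\<i>/2) * (t - (1 - z\<^sup>2) / t)
     | Cz \<Rightarrow> z)"

lemma K_const_hom:
  "K_const a + K_const b = K_const (a + b)" "K_const a * K_const b = K_const (a * b)"
  "K_const 1 = 1" "K_const 0 = 0"
  by (simp_all add: K_const_def Cz_embed_def Cz_const_def
        flip: one_pCons One_fract_def Zero_fract_def)

lemma psi_psi_inv: "psi (psi_inv (t, z)) = (t, z)"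
proof -
  have "K_const (1/2) * (t + s) - K_const \<i> * (K_const (\<i>/2) * (t - s)) = t" for s
  proof -
    have m: "K_const (-1/2) = - K_const (1/2)"
      using K_const_hom(1)[of "-1/2" "1/2"] K_const_hom(4) by (simp add: eq_neg_iff_add_eq_0)
    have e: "K_const \<i> * (K_const (\<i>/2) * (t - s)) = K_const (-1/2) * (t - s)"
      by (simp only: mult.assoc[symmetric] K_const_hom(2)) simp
    have "K_const (1/2) * (t + s) - K_const \<i> * (K_const (\<i>/2) * (t - s))
        = (K_const (1/2) + K_const (1/2)) * t"
      unfolding e m by (simp add: algebra_simps)
    then show ?thesis by (simp add: K_const_hom)
  qed
  then show ?thesis by (simp add: psi_def psi_inv_def)
qed

lemma psi_inv_in_S: "t \<noteq> 0 \<Longrightarrow> psi_inv (t, z) \<in> S_points"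
proof -
  assume t: "t \<noteq> 0"
  define s where "s = (1 - z\<^sup>2) / t"
  have "K_const (1/4) + K_const (-1/4) = 0" "4 * K_const (1/4) = (1::K_field)"
  proof -
    show "K_const (1/4) + K_const (-1/4) = 0" by (simp add: K_const_hom)
    have "4 * K_const (1/4) = (K_const (1/4) + K_const (1/4)) + (K_const (1/4) + K_const (1/4))"
      by simp
    then show "4 * K_const (1/4) = 1" by (simp only: K_const_hom) (simp add: K_const_hom)
  qed
  then have q: "K_const (-1/4) = - K_const (1/4)" "4 * K_const (1/4) = (1::K_field)"
    by (auto simp: eq_neg_iff_add_eq_0 add.commute)
  have "(K_const (1/2) * (t + s))\<^sup>2 = K_const (1/4) * (t + s)\<^sup>2"
    "(K_const (\<i>/2) * (t - s))\<^sup>2 = K_const (-1/4) * (t - s)\<^sup>2"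
    by (simp_all add: power_mult_distrib power2_eq_square[of "K_const _"] K_const_hom)
  then have "(K_const (1/2) * (t + s))\<^sup>2 + (K_const (\<i>/2) * (t - s))\<^sup>2
      = (4 * K_const (1/4)) * (t * s)"
    unfolding q(1) by (simp add: power2_eq_square algebra_simps)
  also have "\<dots> = 1 - z\<^sup>2" using t unfolding q by (simp add: s_def)
  finally show ?thesis
    by (auto simp: S_points_def psi_inv_def s_def intro!: exI[of _ Cw])
qed

text \<open>The birational map of the plane given by a matrix over C(z).\<close>

definition moebius :: "Cz_field^2^2 \<Rightarrow> K_field \<times> K_field" where
  "moebius M =
     ((Cz_embed (M$1$1) * gen_t + Cz_embed (M$1$2)) / (Cz_embed (M$2$1) * gen_t + Cz_embed (M$2$2)),
      gen_z)"

text \<open>The composition of psi, F and the inverse of psi, where F is given by real forms. If the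
  w-coordinate of F vanishes, division by zero makes the second component 0, which is not \<open>gen_z\<close>.\<close>

definition psi_conj :: "(coord \<Rightarrow> rpoly) \<Rightarrow> K_field \<times> K_field" where
  "psi_conj F =
     psi (\<lambda>i. ev (\<lambda>r. K_const (complex_of_real r)) (psi_inv (gen_t, gen_z)) (F i))"

definition H_group :: "(Cz_field^2^2) set set" where
  "H_group = {A \<in> carrier PGL2. \<exists>F\<in>Aut_S_pi. \<exists>M\<in>A. psi_conj F = moebius M}"

definition R_rot :: "real \<Rightarrow> (Cz_field^2^2) set" where
  "R_rot \<theta> = pgl_class 1 0 0 (Cz_const (exp (\<i> * complex_of_real \<theta>)))"

end

theory Submission
  imports Defs "HOL-Computational_Algebra.Polynomial_Factorial"
begin

text \<open>Write h for 1 - z^2 and let a bar conjugate the coefficients of a polynomial in z. In the chart w = 1 put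
t = x - iy and u = x + iy; then t u = h on S, and complex conjugation exchanges t and u, so on the (t, z)
plane it is the antiholomorphic involution sending t to h divided by the conjugate of t. The proof rests on
the matrices

  U(a, c) = (a, h cbar; c, abar), with a and c polynomials in z,

which commute with that involution and act by t |-> t (a + cbar u) / (abar + c t).

\<^bold>\<open>Which matrices occur.\<close> If a abar - h c cbar has no zero on [-1, 1], then U(a, c) comes from an
automorphism of S(\<real>) (\<open>in_H_groupI\<close>): on a real point the factors a + cbar u and abar + c t are conjugate
nonzero numbers, so explicit real forms without real base points can be written down, and (abar, -c)
gives the inverse. Conversely let A lie in the group. Its matrix commutes with the involution, and
Hilbert 90 for complex conjugation on \<complex>(z) shows that either A has order at most two, or A is the
class of some U(a, c); dividing by real linear factors makes a and c free of common real zeros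
(\<open>H_group_normal_form\<close>). The determinant then has no zero inside (-1, 1), because at such a zero the map
contracts a real circle to a point and its inverse cannot be defined there (\<open>nonvanishing_interior\<close>).

\<^bold>\<open>Finite order.\<close> Let \<tau> and \<delta> be trace and determinant of U(a, c). By Cayley-Hamilton the n-th power is
a combination of the matrix and the identity whose coefficients form the Lucas sequence of (\<tau>, \<delta>), so
a scalar n-th power makes the n-th Lucas term vanish. As that term is homogeneous, \<delta>/\<tau>^2 takes only finitely
many values and is constant; the two eigenvalues have equal absolute value at each z where \<tau> does not vanish,
so the constant is 1/4 + y^2 with y real and nonzero (\<open>unitary_finite_order\<close>). Here \<tau> is not zero, since a traceless
matrix has order two.

\<^bold>\<open>Diagonalisation.\<close> Write a = \<tau>/2 + i\<alpha> with \<tau> and \<alpha> real. The eigenvalues are \<tau>(1/2 + iy) and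
\<tau>(1/2 - iy), and \<alpha>^2 - h c cbar = (y\<tau>)^2. The trace has no zero on [-1, 1]: inside because \<delta> has none, at
z = 1 and z = -1 because a zero there would be a common zero of a and c (\<open>trace_nonzero_at_poles\<close>). Hence
\<alpha>^2 \<ge> (y\<tau>)^2 > 0 there, the product y\<tau>\<alpha> has constant sign, and after exchanging y and -y it is positive.
The eigenvectors of U(a, c) are the columns of P = U(i(y\<tau> + \<alpha>), c), whose determinant 2y\<tau>(y\<tau> + \<alpha>)
is positive on [-1, 1]. So P lies in the group, and conjugating by P turns U(a, c) into a diagonal matrix
with entries of quotient (1/2 - iy)/(1/2 + iy), a number of absolute value one: a rotation
(\<open>conjugate_to_rotation\<close>).\<close>

section \<open>Evaluation of real forms\<close>
text \<open>Evaluation is a ring homomorphism as soon as the structure map is one. The rings of interest are \<complex>, the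
function field of the plane, and the polynomials in t and z.\<close>

locale structure_map =
  fixes \<phi> :: "real \<Rightarrow> 'b::comm_ring_1"
  assumes add: "\<phi> (a + b) = \<phi> a + \<phi> b"
    and mult: "\<phi> (a * b) = \<phi> a * \<phi> b"
    and one: "\<phi> 1 = 1"
begin

lemma zero: "\<phi> 0 = 0"
  using add[of 0 0] by simp

definition monomial_value :: "(coord \<Rightarrow> 'b) \<Rightarrow> (coord \<Rightarrow>\<^sub>0 nat) \<Rightarrow> 'b" where
  "monomial_value v m = (\<Prod>i\<in>Poly_Mapping.keys m. v i ^ Poly_Mapping.lookup m i)"

lemma monomial_value_superset:
  assumes "finite A" "Poly_Mapping.keys m \<subseteq> A"
  shows "monomial_value v m = (\<Prod>i\<in>A. v i ^ Poly_Mapping.lookup m i)"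
  unfolding monomial_value_def using assms
  by (intro prod.mono_neutral_left) (auto simp: in_keys_iff)

lemma monomial_value_add: "monomial_value v (m + n) = monomial_value v m * monomial_value v n"
proof -
  let ?A = "Poly_Mapping.keys m \<union> Poly_Mapping.keys n"
  have "Poly_Mapping.keys (m + n) \<subseteq> ?A" by (rule keys_add)
  then show ?thesis
    by (simp add: monomial_value_superset[of ?A] lookup_add power_add prod.distrib)
qed

lemma ev_superset:
  assumes "finite A" "Poly_Mapping.keys p \<subseteq> A"
  shows "ev \<phi> v p = (\<Sum>m\<in>A. \<phi> (Poly_Mapping.lookup p m) * monomial_value v m)"
  unfolding ev_def monomial_value_def using assms
  by (intro sum.mono_neutral_left) (auto simp: in_keys_iff zero)

lemma ev_add: "ev \<phi> v (p + q) = ev \<phi> v p + ev \<phi> v q"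
proof -
  let ?A = "Poly_Mapping.keys p \<union> Poly_Mapping.keys q"
  have "Poly_Mapping.keys (p + q) \<subseteq> ?A" by (rule keys_add)
  then show ?thesis
    by (simp add: ev_superset[of ?A] lookup_add add distrib_right sum.distrib)
qed

lemma ev_zero: "ev \<phi> v 0 = 0"
  by (simp add: ev_def)

lemma ev_sum: "ev \<phi> v (sum f A) = (\<Sum>i\<in>A. ev \<phi> v (f i))"
  by (induction A rule: infinite_finite_induct) (simp_all add: ev_zero ev_add)

lemma ev_single: "ev \<phi> v (Poly_Mapping.single m r) = \<phi> r * monomial_value v m"
  by (cases "r = 0") (simp_all add: ev_def monomial_value_def zero)

lemma ev_constant: "ev \<phi> v (Poly_Mapping.single 0 r) = \<phi> r"
  by (simp add: ev_single monomial_value_def)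

lemma ev_one: "ev \<phi> v 1 = 1"
  using ev_constant[of v 1] by (simp add: one)

lemma ev_Var: "ev \<phi> v (Var i) = v i"
  by (simp add: Var_def ev_single monomial_value_def one)

lemma sum_of_monomials:
  "p = (\<Sum>m\<in>Poly_Mapping.keys p. Poly_Mapping.single m (Poly_Mapping.lookup p m))"
  by (rule poly_mapping_eqI) (auto simp: lookup_sum lookup_single when_def in_keys_iff)

lemma ev_mult: "ev \<phi> v (p * q) = ev \<phi> v p * ev \<phi> v q"
proof -
  have "p * q = (\<Sum>m\<in>Poly_Mapping.keys p. \<Sum>n\<in>Poly_Mapping.keys q.
      Poly_Mapping.single (m + n) (Poly_Mapping.lookup p m * Poly_Mapping.lookup q n))"
    by (subst sum_of_monomials[of p], subst sum_of_monomials[of q])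
      (simp add: sum_product mult_single)
  also have "ev \<phi> v \<dots> = (\<Sum>m\<in>Poly_Mapping.keys p. \<phi> (Poly_Mapping.lookup p m) * monomial_value v m) *
      (\<Sum>n\<in>Poly_Mapping.keys q. \<phi> (Poly_Mapping.lookup q n) * monomial_value v n)"
    by (simp add: ev_sum ev_single mult monomial_value_add sum_product algebra_simps)
  finally show ?thesis
    by (simp add: ev_def monomial_value_def)
qed

lemma ev_uminus: "ev \<phi> v (- p) = - ev \<phi> v p"
  using ev_add[of v p "- p"] by (simp add: ev_zero eq_neg_iff_add_eq_0 add.commute)

lemma ev_diff: "ev \<phi> v (p - q) = ev \<phi> v p - ev \<phi> v q"
  using ev_add[of v "p - q" q] by simp

lemma ev_power: "ev \<phi> v (p ^ n) = ev \<phi> v p ^ n"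
  by (induction n) (simp_all add: ev_one ev_mult)

lemma ev_two: "ev \<phi> v 2 = 2"
  using ev_add[of v 1 1] by (simp add: ev_one)

lemmas ev_hom = ev_add ev_zero ev_sum ev_constant ev_one ev_Var ev_mult ev_uminus ev_diff ev_power
  ev_two

end

lemma structure_map_of_real: "structure_map (of_real :: real \<Rightarrow> 'a::{real_algebra_1,comm_ring_1})"
  by unfold_locales auto

text \<open>The tool by which identities move between the function field, polynomials, and complex or real points.\<close>

lemma ev_natural:
  fixes \<phi> :: "real \<Rightarrow> 'b::comm_ring_1" and \<eta> :: "'b \<Rightarrow> 'c::comm_ring_1"
  assumes "\<And>a b. \<eta> (a + b) = \<eta> a + \<eta> b" "\<And>a b. \<eta> (a * b) = \<eta> a * \<eta> b" "\<eta> 1 = 1"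
  shows "\<eta> (ev \<phi> v p) = ev (\<lambda>r. \<eta> (\<phi> r)) (\<lambda>i. \<eta> (v i)) p"
proof -
  have zero: "\<eta> 0 = 0" using assms(1)[of 0 0] by simp
  have sum: "\<eta> (sum f A) = (\<Sum>i\<in>A. \<eta> (f i))" for f :: "(coord \<Rightarrow>\<^sub>0 nat) \<Rightarrow> 'b" and A
    by (induction A rule: infinite_finite_induct) (simp_all add: zero assms)
  have prod: "\<eta> (prod f A) = (\<Prod>i\<in>A. \<eta> (f i))" for f :: "coord \<Rightarrow> 'b" and A
    by (induction A rule: infinite_finite_induct) (simp_all add: assms)
  have power: "\<eta> (a ^ n) = \<eta> a ^ n" for a n
    by (induction n) (simp_all add: assms)
  show ?thesis by (simp add: ev_def sum prod power assms)
qed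

lemma ev_comp_map:
  assumes "structure_map \<phi>"
  shows "ev \<phi> v (comp_map F G i) = ev \<phi> (\<lambda>j. ev \<phi> v (G j)) (F i)"
proof -
  interpret structure_map \<phi> by fact
  show ?thesis
    by (simp add: comp_map_def ev_natural[where \<eta> = "ev \<phi> v"] ev_hom)
qed

lemma ev_homogeneous:
  fixes \<phi> :: "real \<Rightarrow> 'b::comm_ring_1"
  assumes "homogeneous d p"
  shows "ev \<phi> (\<lambda>i. k * v i) p = k ^ d * ev \<phi> v p"
proof -
  have "\<phi> (Poly_Mapping.lookup p m) * (\<Prod>i\<in>Poly_Mapping.keys m. (k * v i) ^ Poly_Mapping.lookup m i)
      = k ^ d * (\<phi> (Poly_Mapping.lookup p m) *
          (\<Prod>i\<in>Poly_Mapping.keys m. v i ^ Poly_Mapping.lookup m i))"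
    if "m \<in> Poly_Mapping.keys p" for m
  proof -
    have "(\<Prod>i\<in>Poly_Mapping.keys m. k ^ Poly_Mapping.lookup m i) = k ^ d"
      using assms that by (simp add: homogeneous_def power_sum[symmetric])
    then show ?thesis by (simp add: power_mult_distrib prod.distrib algebra_simps)
  qed
  then show ?thesis by (simp add: ev_def sum_distrib_left)
qed

lemma total_degree_superset:
  assumes "finite A" "Poly_Mapping.keys m \<subseteq> A"
  shows "(\<Sum>i\<in>Poly_Mapping.keys m. Poly_Mapping.lookup m i) = (\<Sum>i\<in>A. Poly_Mapping.lookup m i)"
  using assms by (intro sum.mono_neutral_left) (auto simp: in_keys_iff)

lemma total_degree_add:
  "(\<Sum>i\<in>Poly_Mapping.keys (m + n). Poly_Mapping.lookup (m + n :: coord \<Rightarrow>\<^sub>0 nat) i)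
    = (\<Sum>i\<in>Poly_Mapping.keys m. Poly_Mapping.lookup m i)
      + (\<Sum>i\<in>Poly_Mapping.keys n. Poly_Mapping.lookup n i)"
proof -
  let ?A = "Poly_Mapping.keys m \<union> Poly_Mapping.keys n"
  have "(\<Sum>i\<in>Poly_Mapping.keys (m + n). Poly_Mapping.lookup (m + n) i)
      = (\<Sum>i\<in>?A. Poly_Mapping.lookup (m + n) i)"
    by (rule total_degree_superset[OF _ keys_add]) simp
  then show ?thesis
    by (simp add: total_degree_superset[of ?A m] total_degree_superset[of ?A n]
        lookup_add sum.distrib)
qed

lemma homogeneous_zero: "homogeneous d 0"
  by (simp add: homogeneous_def)

lemma homogeneous_add: "homogeneous d p \<Longrightarrow> homogeneous d q \<Longrightarrow> homogeneous d (p + q)"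
  using keys_add[of p q] by (auto simp: homogeneous_def)

lemma homogeneous_uminus: "homogeneous d p \<Longrightarrow> homogeneous d (- p)"
  by (auto simp: homogeneous_def in_keys_iff)

lemma homogeneous_diff: "homogeneous d p \<Longrightarrow> homogeneous d q \<Longrightarrow> homogeneous d (p - q)"
  using homogeneous_add[of d p "- q"] by (simp add: homogeneous_uminus)

lemma homogeneous_sum: "(\<And>i. i \<in> A \<Longrightarrow> homogeneous d (f i)) \<Longrightarrow> homogeneous d (sum f A)"
  by (induction A rule: infinite_finite_induct) (simp_all add: homogeneous_zero homogeneous_add)

lemma homogeneous_mult:
  assumes "homogeneous d p" "homogeneous e q"
  shows "homogeneous (d + e) (p * q)"
  unfolding homogeneous_def
proof
  fix k assume "k \<in> Poly_Mapping.keys (p * q)"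
  then obtain m n where "m \<in> Poly_Mapping.keys p" "n \<in> Poly_Mapping.keys q" "k = m + n"
    using keys_mult[of p q] by blast
  then show "(\<Sum>i\<in>Poly_Mapping.keys k. Poly_Mapping.lookup k i) = d + e"
    using assms by (simp add: homogeneous_def total_degree_add)
qed

lemma homogeneous_constant: "homogeneous 0 (Poly_Mapping.single 0 r)"
  by (simp add: homogeneous_def)

lemma homogeneous_Var: "homogeneous 1 (Var i)"
  by (simp add: homogeneous_def Var_def)

lemma homogeneous_power: "homogeneous d p \<Longrightarrow> homogeneous (n * d) (p ^ n)"
proof (induction n)
  case 0
  then show ?case using homogeneous_constant[of 1] by simp
next
  case (Suc n)
  then show ?case using homogeneous_mult[of d p "n * d" "p ^ n"] by simp
qed

text \<open>The composition of two families consists of forms of one degree; the other part of being a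
rational map is that they do not all vanish on S.\<close>

lemma homogeneous_comp_map:
  assumes "\<And>i. homogeneous d (F i)" "\<And>i. homogeneous e (G i)"
  shows "homogeneous (d * e) (comp_map F G i)"
proof -
  have prod: "homogeneous (\<Sum>i\<in>A. f i * e) (\<Prod>i\<in>A. G i ^ f i)" for A and f :: "coord \<Rightarrow> nat"
  proof (induction A rule: infinite_finite_induct)
    case (insert i A)
    then show ?case
      by (simp add: homogeneous_mult homogeneous_power assms)
  qed (use homogeneous_constant[of 1] in simp_all)
  show ?thesis
    unfolding comp_map_def ev_def
  proof (rule homogeneous_sum)
    fix m assume "m \<in> Poly_Mapping.keys (F i)"
    then have "(\<Sum>j\<in>Poly_Mapping.keys m. Poly_Mapping.lookup m j * e) = d * e"
      using assms(1)[of i] by (simp add: homogeneous_def sum_distrib_right[symmetric])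
    then show "homogeneous (d * e) (Poly_Mapping.single 0 (Poly_Mapping.lookup (F i) m) *
        (\<Prod>j\<in>Poly_Mapping.keys m. G j ^ Poly_Mapping.lookup m j))"
      using homogeneous_mult[OF homogeneous_constant
          prod[of "Poly_Mapping.lookup m" "Poly_Mapping.keys m"]] by simp
  qed
qed

section \<open>Matrices modulo scalars\<close>
abbreviation mat2 :: "'a::field \<Rightarrow> 'a \<Rightarrow> 'a \<Rightarrow> 'a \<Rightarrow> 'a^2^2" where
  "mat2 a b c d \<equiv> vector [vector [a, b], vector [c, d]]"

text \<open>The element of the projective linear group given by an invertible matrix.\<close>

abbreviation proj :: "'a::field^2^2 \<Rightarrow> ('a^2^2) set" where
  "proj M \<equiv> scalars2 #>\<^bsub>GL2\<^esub> M"

lemma mat2_eqI: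
  "M$1$1 = N$1$1 \<Longrightarrow> M$1$2 = N$1$2 \<Longrightarrow> M$2$1 = N$2$1 \<Longrightarrow> M$2$2 = N$2$2 \<Longrightarrow> M = (N :: 'a^2^2)"
  by (simp add: vec_eq_iff forall_2)

lemma mat2_mult:
  "mat2 a b c d ** mat2 a' b' c' d' =
    mat2 (a * a' + b * c') (a * b' + b * d') (c * a' + d * c') (c * b' + d * d')"
  by (rule mat2_eqI) (simp_all add: matrix_matrix_mult_def sum_2)

lemma mat_mat2: "mat k = mat2 k 0 0 k"
  by (rule mat2_eqI) (simp_all add: mat_def)

lemma invertible_mat2: "invertible (mat2 a b c d) \<longleftrightarrow> a * d - b * c \<noteq> 0"
  by (simp add: invertible_det_nz det_2)

lemma proj_altdef: "proj M = {mat k ** M | k. k \<noteq> 0}"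
  by (auto simp: r_coset_def scalars2_def GL2_def)

lemma in_proj_self: "M \<in> proj M"
  unfolding proj_altdef by (auto intro!: exI[of _ 1])

lemma proj_scale:
  assumes "k \<noteq> 0"
  shows "proj (mat k ** M) = proj M"
proof -
  have scaled: "mat j ** (mat k ** M) = mat (j * k) ** M" for j
    by (simp add: matrix_mul_assoc mat_mult_mat)
  show ?thesis
  proof (intro equalityI subsetI)
    fix N assume "N \<in> proj (mat k ** M)"
    then obtain j where "j \<noteq> 0" "N = mat (j * k) ** M"
      unfolding proj_altdef scaled by blast
    then show "N \<in> proj M"
      unfolding proj_altdef using assms by (intro CollectI exI[of _ "j * k"]) simp
  next
    fix N assume "N \<in> proj M"
    then obtain j where "j \<noteq> 0" "N = mat j ** M"
      unfolding proj_altdef by blast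
    then show "N \<in> proj (mat k ** M)"
      unfolding proj_altdef scaled using assms by (intro CollectI exI[of _ "j / k"]) simp
  qed
qed

lemma proj_mat2_scale:
  assumes "k \<noteq> 0"
  shows "proj (mat2 (k * a) (k * b) (k * c) (k * d)) = proj (mat2 a b c d)"
  using proj_scale[OF assms, of "mat2 a b c d"] by (simp add: mat_mat2 mat2_mult)

lemma proj_mult:
  assumes "invertible M" "invertible N"
  shows "proj M \<otimes>\<^bsub>PGL2\<^esub> proj N = proj (M ** N)"
  using normal.rcos_sum[OF normal_scalars2, of M N] assms
  by (simp add: PGL2_def FactGroup_def GL2_def)

lemma proj_in_PGL2: "invertible M \<Longrightarrow> proj M \<in> carrier PGL2"
  by (auto simp: PGL2_def FactGroup_def RCOSETS_def GL2_def)

lemma one_PGL2: "\<one>\<^bsub>PGL2\<^esub> = proj (mat 1)"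
  unfolding proj_altdef by (auto simp: PGL2_def FactGroup_def scalars2_def)

lemma PGL2_memberD:
  assumes "A \<in> carrier PGL2" "M \<in> A"
  shows "A = proj M" "invertible M"
proof -
  obtain N where N: "A = proj N" "invertible N"
    using assms(1) by (auto simp: PGL2_def FactGroup_def RCOSETS_def GL2_def)
  then obtain k where k: "k \<noteq> 0" "M = mat k ** N"
    using assms(2) unfolding proj_altdef by auto
  show "A = proj M" using N k by (simp add: proj_scale)
  show "invertible M" using N k by (simp add: invertible_mult mat_invertible)
qed

lemma proj_eq_one_iff: "proj M = \<one>\<^bsub>PGL2\<^esub> \<longleftrightarrow> (\<exists>k. k \<noteq> 0 \<and> M = mat k)"
proof
  assume "proj M = \<one>\<^bsub>PGL2\<^esub>"
  then have "M \<in> proj (mat 1)" using in_proj_self[of M] by (simp add: one_PGL2)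
  then show "\<exists>k. k \<noteq> 0 \<and> M = mat k" unfolding proj_altdef by auto
next
  assume "\<exists>k. k \<noteq> 0 \<and> M = mat k"
  then show "proj M = \<one>\<^bsub>PGL2\<^esub>"
    using proj_scale[of _ "mat 1"] by (auto simp: one_PGL2)
qed

lemma inv_proj:
  assumes "invertible M" "invertible N" "N ** M = mat k" "k \<noteq> 0"
  shows "inv\<^bsub>PGL2\<^esub> (proj M) = proj N"
  using assms by (intro group.inv_equality[OF group_PGL2] proj_in_PGL2)
    (auto simp: proj_mult proj_eq_one_iff)

section \<open>Real forms attached to a pair of polynomials\<close>
abbreviation pbar :: "complex poly \<Rightarrow> complex poly" where
  "pbar a \<equiv> map_poly cnj a"

lemma pbar_add: "pbar (a + b) = pbar a + pbar b"
  by (rule poly_eqI) (simp add: coeff_map_poly)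

lemma pbar_uminus: "pbar (- a) = - pbar a"
  by (rule poly_eqI) (simp add: coeff_map_poly)

lemma pbar_mult: "pbar (a * b) = pbar a * pbar b"
  by (rule poly_eqI) (simp add: coeff_map_poly coeff_mult)

lemma pbar_pbar: "pbar (pbar a) = a"
  by (rule poly_eqI) (simp add: coeff_map_poly)

lemma degree_pbar: "Polynomial.degree (pbar a) = Polynomial.degree a"
  by (simp add: degree_map_poly)

definition hpoly :: "complex poly" where
  "hpoly = [:1, 0, -1:]"

lemma poly_hpoly: "poly hpoly z = 1 - z\<^sup>2"
  by (simp add: hpoly_def power2_eq_square)

lemma pbar_hpoly: "pbar hpoly = hpoly"
  by (simp add: hpoly_def map_poly_pCons)


text \<open>The form of degree m in w and z that equals r(z) on w = 1, for m at least the degree of r.\<close>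

definition homogenize :: "nat \<Rightarrow> real poly \<Rightarrow> rpoly" where
  "homogenize m r = (\<Sum>k\<le>m. Poly_Mapping.single 0 (poly.coeff r k) * (Var Cw ^ (m - k) * Var Cz ^ k))"

lemma homogeneous_homogenize: "homogeneous m (homogenize m r)"
  unfolding homogenize_def
proof (rule homogeneous_sum)
  fix k assume "k \<in> {..m}"
  then have "0 + ((m - k) * 1 + k * 1) = m" by simp
  then show "homogeneous m (Poly_Mapping.single 0 (poly.coeff r k) * (Var Cw ^ (m - k) * Var Cz ^ k))"
    by (metis homogeneous_mult homogeneous_constant homogeneous_power homogeneous_Var)
qed

text \<open>With D the homogenization of abar + c t, where t = x - iy, the forms \<open>den_re\<close> and \<open>den_im\<close> are E and F
in D = E + iF.\<close>

definition den_re :: "nat \<Rightarrow> complex poly \<Rightarrow> complex poly \<Rightarrow> rpoly" where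
  "den_re m a c = Var Cw * homogenize m (map_poly Re a)
     + (Var Cx * homogenize m (map_poly Re c) + Var Cy * homogenize m (map_poly Im c))"

definition den_im :: "nat \<Rightarrow> complex poly \<Rightarrow> complex poly \<Rightarrow> rpoly" where
  "den_im m a c = (Var Cx * homogenize m (map_poly Im c) - Var Cy * homogenize m (map_poly Re c))
     - Var Cw * homogenize m (map_poly Im a)"

text \<open>The map t |-> t Dbar / D without denominators: multiply (w : t : u : z) by D Dbar = E^2 + F^2 to obtain
(w D Dbar : t Dbar^2 : u D^2 : z D Dbar), and read off x and y from x + iy = u. These are real forms.\<close>

definition family :: "nat \<Rightarrow> complex poly \<Rightarrow> complex poly \<Rightarrow> coord \<Rightarrow> rpoly" where
  "family m a c i = (let E = den_re m a c; F = den_im m a c in case i of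
       Cw \<Rightarrow> Var Cw * (E * E + F * F)
     | Cx \<Rightarrow> Var Cx * (E * E - F * F) - (Var Cy * (E * F) + Var Cy * (E * F))
     | Cy \<Rightarrow> Var Cy * (E * E - F * F) + (Var Cx * (E * F) + Var Cx * (E * F))
     | Cz \<Rightarrow> Var Cz * (E * E + F * F))"

lemma homogeneous_family: "homogeneous (1 + ((1 + m) + (1 + m))) (family m a c i)"
proof -
  have E: "homogeneous (1 + m) (den_re m a c)" and F: "homogeneous (1 + m) (den_im m a c)"
    unfolding den_re_def den_im_def
    by (intro homogeneous_add homogeneous_diff homogeneous_mult homogeneous_Var
        homogeneous_homogenize)+
  show ?thesis
    unfolding family_def Let_def
    by (cases i; simp only: coord.case;
        intro homogeneous_add homogeneous_diff homogeneous_mult homogeneous_Var E F)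
qed

text \<open>Over a complex algebra the two factors E + iF and E - iF of E^2 + F^2 separate; the calculations
with the family use these factors only.\<close>

locale complex_structure =
  fixes \<kappa> :: "complex \<Rightarrow> 'b::comm_ring_1"
  assumes const_add: "\<kappa> (a + b) = \<kappa> a + \<kappa> b"
    and const_mult: "\<kappa> (a * b) = \<kappa> a * \<kappa> b"
    and const_one: "\<kappa> 1 = 1"
begin

lemma const_uminus: "\<kappa> (- a) = - \<kappa> a"
  using const_add[of a "- a"] const_add[of 0 0] by (simp add: eq_neg_iff_add_eq_0 add.commute)

lemma const_diff: "\<kappa> (a - b) = \<kappa> a - \<kappa> b"
  using const_add[of a "- b"] by (simp add: const_uminus)

lemma i_squared: "\<kappa> \<i> * \<kappa> \<i> = - 1"
  by (simp add: const_uminus const_one flip: const_mult)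

sublocale structure_map "\<lambda>r. \<kappa> (complex_of_real r)"
  by unfold_locales (simp_all add: const_add const_mult const_one)

definition form :: "nat \<Rightarrow> complex poly \<Rightarrow> 'b \<Rightarrow> 'b \<Rightarrow> 'b" where
  "form m a w z = (\<Sum>k\<le>m. \<kappa> (poly.coeff a k) * (w ^ (m - k) * z ^ k))"

lemma form_scale: "form m a (l * w) (l * z) = l ^ m * form m a w z"
proof -
  have "\<kappa> (poly.coeff a k) * ((l * w) ^ (m - k) * (l * z) ^ k) =
      l ^ m * (\<kappa> (poly.coeff a k) * (w ^ (m - k) * z ^ k))" if "k \<le> m" for k
  proof -
    have "l ^ m = l ^ (m - k) * l ^ k" using that by (simp flip: power_add)
    then show ?thesis by (simp add: power_mult_distrib algebra_simps)
  qed
  then show ?thesis by (simp add: form_def sum_distrib_left)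
qed

lemma form_uminus: "form m (- a) w z = - form m a w z"
  by (simp add: form_def const_uminus sum_negf)

lemma form_re_im:
  assumes "E = ev (\<lambda>r. \<kappa> (complex_of_real r)) v (homogenize m (map_poly Re a))"
    and "F = ev (\<lambda>r. \<kappa> (complex_of_real r)) v (homogenize m (map_poly Im a))"
  shows "E + \<kappa> \<i> * F = form m a (v Cw) (v Cz)"
    and "E - \<kappa> \<i> * F = form m (pbar a) (v Cw) (v Cz)"
proof -
  have re_im: "\<kappa> (poly.coeff a k) = \<kappa> (complex_of_real (Re (poly.coeff a k)))
      + \<kappa> \<i> * \<kappa> (complex_of_real (Im (poly.coeff a k)))"
    "\<kappa> (cnj (poly.coeff a k)) = \<kappa> (complex_of_real (Re (poly.coeff a k)))
      - \<kappa> \<i> * \<kappa> (complex_of_real (Im (poly.coeff a k)))" for k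
    unfolding const_mult[symmetric] const_add[symmetric] const_diff[symmetric]
    by (rule arg_cong[where f = \<kappa>], simp add: complex_eq_iff)+
  show "E + \<kappa> \<i> * F = form m a (v Cw) (v Cz)" "E - \<kappa> \<i> * F = form m (pbar a) (v Cw) (v Cz)"
    unfolding assms form_def homogenize_def ev_hom
    by (simp_all add: coeff_map_poly re_im distrib_right left_diff_distrib
        sum.distrib sum_distrib_left sum_subtractf mult.assoc)
qed

definition den :: "nat \<Rightarrow> complex poly \<Rightarrow> complex poly \<Rightarrow> (coord \<Rightarrow> 'b) \<Rightarrow> 'b" where
  "den m a c v = v Cw * form m (pbar a) (v Cw) (v Cz)
     + form m c (v Cw) (v Cz) * (v Cx - \<kappa> \<i> * v Cy)"

definition num :: "nat \<Rightarrow> complex poly \<Rightarrow> complex poly \<Rightarrow> (coord \<Rightarrow> 'b) \<Rightarrow> 'b" where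
  "num m a c v = v Cw * form m a (v Cw) (v Cz)
     + form m (pbar c) (v Cw) (v Cz) * (v Cx + \<kappa> \<i> * v Cy)"

lemma ev_den_re_im:
  fixes v :: "coord \<Rightarrow> 'b"
  assumes E_def: "E = ev (\<lambda>r. \<kappa> (complex_of_real r)) v (den_re m a c)"
    and F_def: "F = ev (\<lambda>r. \<kappa> (complex_of_real r)) v (den_im m a c)"
  shows "E + \<kappa> \<i> * F = den m a c v" "E - \<kappa> \<i> * F = num m a c v"
proof -
  let ?e = "ev (\<lambda>r. \<kappa> (complex_of_real r)) v"
  let ?I = "\<kappa> \<i>"
  define ar ai cr ci where "ar = ?e (homogenize m (map_poly Re a))"
    and "ai = ?e (homogenize m (map_poly Im a))"
    and "cr = ?e (homogenize m (map_poly Re c))" and "ci = ?e (homogenize m (map_poly Im c))"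
  note defs = ar_def ai_def cr_def ci_def
  have E: "E = v Cw * ar + (v Cx * cr + v Cy * ci)"
    and F: "F = (v Cx * ci - v Cy * cr) - v Cw * ai"
    by (simp_all add: E_def F_def den_re_def den_im_def ev_hom defs)
  note forms = form_re_im[OF ar_def ai_def] form_re_im[OF cr_def ci_def]
  have II: "?I * (?I * x) = - x" for x
    using i_squared by (simp flip: mult.assoc)
  show "E + ?I * F = den m a c v" "E - ?I * F = num m a c v"
    unfolding E F den_def num_def forms[symmetric]
    by (simp_all add: algebra_simps II)
qed

lemma ev_family:
  fixes v :: "coord \<Rightarrow> 'b"
  assumes G_def: "\<And>i. G i = ev (\<lambda>r. \<kappa> (complex_of_real r)) v (family m a c i)"
  shows "G Cw = v Cw * (den m a c v * num m a c v)"
    and "G Cz = v Cz * (den m a c v * num m a c v)"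
    and "G Cx - \<kappa> \<i> * G Cy = (v Cx - \<kappa> \<i> * v Cy) * (num m a c v * num m a c v)"
    and "G Cx + \<kappa> \<i> * G Cy = (v Cx + \<kappa> \<i> * v Cy) * (den m a c v * den m a c v)"
proof -
  have II: "\<kappa> \<i> * (\<kappa> \<i> * x) = - x" for x
    using i_squared by (simp flip: mult.assoc)
  define E F where "E = ev (\<lambda>r. \<kappa> (complex_of_real r)) v (den_re m a c)"
    and "F = ev (\<lambda>r. \<kappa> (complex_of_real r)) v (den_im m a c)"
  have dn: "den m a c v = E + \<kappa> \<i> * F" "num m a c v = E - \<kappa> \<i> * F"
    using ev_den_re_im[OF E_def F_def] by simp_all
  show "G Cw = v Cw * (den m a c v * num m a c v)" "G Cz = v Cz * (den m a c v * num m a c v)"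
    "G Cx - \<kappa> \<i> * G Cy = (v Cx - \<kappa> \<i> * v Cy) * (num m a c v * num m a c v)"
    "G Cx + \<kappa> \<i> * G Cy = (v Cx + \<kappa> \<i> * v Cy) * (den m a c v * den m a c v)"
    unfolding G_def family_def Let_def dn
    by (simp_all add: ev_hom E_def[symmetric] F_def[symmetric]) (simp_all add: algebra_simps II)
qed

end

interpretation cx: complex_structure "\<lambda>a. a :: complex"
  by unfold_locales auto

lemma form_eq_poly:
  assumes "Polynomial.degree a \<le> m" "w \<noteq> 0"
  shows "cx.form m a w z = w ^ m * poly a (z / w)"
proof -
  have "poly.coeff a k * (w ^ (m - k) * z ^ k) = w ^ m * (poly.coeff a k * (z / w) ^ k)" if "k \<le> m" for k
    using that assms by (simp add: power_divide power_diff)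
  then have "cx.form m a w z = w ^ m * (\<Sum>k\<le>m. poly.coeff a k * (z / w) ^ k)"
    unfolding cx.form_def sum_distrib_left by (intro sum.cong) auto
  also have "(\<Sum>k\<le>m. poly.coeff a k * (z / w) ^ k) = poly a (z / w)"
    unfolding poly_altdef using assms by (intro sum.mono_neutral_right) (auto simp: coeff_eq_0)
  finally show ?thesis .
qed

lemma S_point_product:
  assumes "v \<in> S_points"
  shows "(v Cx - \<i> * v Cy) * (v Cx + \<i> * v Cy) = (v Cw)\<^sup>2 - (v Cz)\<^sup>2"
  using assms by (auto simp: S_points_def algebra_simps power2_eq_square)

lemma S_pointI:
  assumes "v i \<noteq> 0" "(v Cx - \<i> * v Cy) * (v Cx + \<i> * v Cy) = (v Cw)\<^sup>2 - (v Cz)\<^sup>2"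
  shows "v \<in> S_points"
  using assms by (auto simp: S_points_def algebra_simps power2_eq_square)

text \<open>Up to a power of a common factor, the factors of the composition are those of the inverse pair,
exchanged and multiplied by the determinant: with
t u = w^2 - z^2 the mixed terms cancel, as in the product of a matrix with its adjugate. So the
composition is the identity times a form.\<close>

lemma ev_family_comp:
  fixes v :: "coord \<Rightarrow> complex"
  assumes "v \<in> S_points"
  shows "ev complex_of_real v (comp_map (family m a c) (family m (pbar a) (- c)) i)
      = (cx.den m (pbar a) (- c) v * cx.num m (pbar a) (- c) v) ^ (2 * m + 2) *
        ((v Cw)\<^sup>2 * cx.form m a (v Cw) (v Cz) * cx.form m (pbar a) (v Cw) (v Cz)
          - ((v Cw)\<^sup>2 - (v Cz)\<^sup>2) * cx.form m c (v Cw) (v Cz) * cx.form m (pbar c) (v Cw) (v Cz))\<^sup>2 * v i"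
proof -
  define t u w z where "t = v Cx - \<i> * v Cy" and "u = v Cx + \<i> * v Cy"
    and "w = v Cw" and "z = v Cz"
  have tu: "t * u = w\<^sup>2 - z\<^sup>2" using S_point_product[OF assms] by (simp add: t_def u_def w_def z_def)
  define A A' C C' where "A = cx.form m a w z" and "A' = cx.form m (pbar a) w z"
    and "C = cx.form m c w z" and "C' = cx.form m (pbar c) w z"
  define D N where "D = cx.den m (pbar a) (- c) v" and "N = cx.num m (pbar a) (- c) v"
  define k where "k = D * N"
  have D: "D = w * A - C * t" and N: "N = w * A' - C' * u"
    by (simp_all add: D_def N_def cx.den_def cx.num_def A_def A'_def C_def C'_def pbar_pbar
        pbar_uminus cx.form_uminus t_def u_def w_def z_def)
  define G where "G = (\<lambda>i. ev complex_of_real v (family m (pbar a) (- c) i))"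
  note G = cx.ev_family[where G = G, OF fun_cong[OF G_def], folded D_def N_def, folded t_def u_def w_def z_def]
  have Gwz: "G Cw = k * w" "G Cz = k * z"
    by (simp_all add: G k_def)
  define \<Delta> where "\<Delta> = w\<^sup>2 * A * A' - (w\<^sup>2 - z\<^sup>2) * C * C'"
  have forms: "cx.form m q (G Cw) (G Cz) = k ^ m * cx.form m q w z" for q
    unfolding Gwz by (rule cx.form_scale)
  have den: "cx.den m a c G = k ^ m * N * \<Delta>"
  proof -
    have "cx.den m a c G = k ^ m * N * (w * D * A' + C * t * N)"
      unfolding cx.den_def forms unfolding G(3) A'_def[symmetric] C_def[symmetric] Gwz k_def
      by (simp add: algebra_simps)
    also have "w * D * A' + C * t * N = w\<^sup>2 * A * A' - (t * u) * C * C'"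
      unfolding D N by (simp add: algebra_simps power2_eq_square)
    finally show ?thesis by (simp add: tu \<Delta>_def)
  qed
  have num: "cx.num m a c G = k ^ m * D * \<Delta>"
  proof -
    have "cx.num m a c G = k ^ m * D * (w * N * A + C' * u * D)"
      unfolding cx.num_def forms unfolding G(4) A_def[symmetric] C'_def[symmetric] Gwz k_def
      by (simp add: algebra_simps)
    also have "w * N * A + C' * u * D = w\<^sup>2 * A * A' - (t * u) * C * C'"
      unfolding D N by (simp add: algebra_simps power2_eq_square)
    finally show ?thesis by (simp add: tu \<Delta>_def)
  qed
  define K where "K = (\<lambda>i. ev complex_of_real G (family m a c i))"
  define l where "l = k ^ (2 * m + 2) * \<Delta>\<^sup>2"
  define q where "q = k ^ m"
  have l: "l = q * q * k * k * \<Delta>\<^sup>2"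
    by (simp add: l_def q_def mult_2 power_add power2_eq_square)
  note K = cx.ev_family[where G = K, OF fun_cong[OF K_def], unfolded den num G(3,4) Gwz, folded q_def]
  have Kwz: "K Cw = l * v Cw" "K Cz = l * v Cz"
    unfolding K l k_def w_def z_def by (simp_all add: algebra_simps power2_eq_square)
  have "K Cx - \<i> * K Cy = l * t" "K Cx + \<i> * K Cy = l * u"
    unfolding K l k_def by (simp_all add: algebra_simps power2_eq_square)
  then have "2 * K Cx = l * (t + u)" "2 * \<i> * K Cy = l * (u - t)"
    by (auto simp: algebra_simps)
  then have Kxy: "K Cx = l * v Cx" "K Cy = l * v Cy"
    by (auto simp: t_def u_def algebra_simps)
  have "K i = l * v i"
    using Kwz Kxy by (cases i) simp_all
  then show ?thesis
    by (simp add: ev_comp_map[OF structure_map_of_real] K_def G_def k_def D_def N_def l_def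
        \<Delta>_def A_def A'_def C_def C'_def w_def z_def)
qed

section \<open>These forms are automorphisms of the real surface\<close>
lemma cnj_form:
  "cnj (cx.form m a (complex_of_real w) (complex_of_real z)) =
    cx.form m (pbar a) (complex_of_real w) (complex_of_real z)"
  by (simp add: cx.form_def coeff_map_poly)

text \<open>The determinant of the matrix with rows (a, h cbar) and (c, abar) has no zero in the given set.\<close>

definition nonvanishing_on :: "real set \<Rightarrow> complex poly \<Rightarrow> complex poly \<Rightarrow> bool" where
  "nonvanishing_on I a c \<longleftrightarrow>
     (\<forall>x\<in>I. poly (a * pbar a - hpoly * c * pbar c) (complex_of_real x) \<noteq> 0)"

lemma nonvanishing_on_inverse:
  "nonvanishing_on I (pbar a) (- c) \<longleftrightarrow> nonvanishing_on I a c"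
  by (simp add: nonvanishing_on_def pbar_pbar pbar_uminus mult.commute)

text \<open>The real points of S lie in the chart w = 1, on the unit sphere.\<close>

lemma real_S_point:
  fixes v :: "coord \<Rightarrow> real"
  assumes "v \<in> S_points"
  shows "v Cw \<noteq> 0" "v Cz / v Cw \<in> {-1..1}"
    "(v Cx / v Cw)\<^sup>2 + (v Cy / v Cw)\<^sup>2 = 1 - (v Cz / v Cw)\<^sup>2"
proof -
  have eq: "(v Cw)\<^sup>2 = (v Cx)\<^sup>2 + (v Cy)\<^sup>2 + (v Cz)\<^sup>2" and nz: "\<exists>i. v i \<noteq> 0"
    using assms by (auto simp: S_points_def)
  show w: "v Cw \<noteq> 0"
  proof
    assume "v Cw = 0"
    with eq have "(v Cx)\<^sup>2 + (v Cy)\<^sup>2 + (v Cz)\<^sup>2 = 0" by simp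
    then have "v Cx = 0" "v Cy = 0" "v Cz = 0"
      by (simp_all add: add_nonneg_eq_0_iff)
    with \<open>v Cw = 0\<close> nz show False by (metis coord.exhaust)
  qed
  have "(v Cx / v Cw)\<^sup>2 + (v Cy / v Cw)\<^sup>2 + (v Cz / v Cw)\<^sup>2 = (v Cw)\<^sup>2 / (v Cw)\<^sup>2"
    unfolding power_divide by (simp only: eq add_divide_distrib)
  then show c: "(v Cx / v Cw)\<^sup>2 + (v Cy / v Cw)\<^sup>2 = 1 - (v Cz / v Cw)\<^sup>2"
    using w by simp
  have "(v Cz / v Cw)\<^sup>2 \<le> 1"
    using c zero_le_power2[of "v Cx / v Cw"] zero_le_power2[of "v Cy / v Cw"] by linarith
  then show "v Cz / v Cw \<in> {-1..1}"
    unfolding abs_square_le_1 abs_le_iff by auto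
qed

text \<open>If abar + c t vanished, then |a|^2 = |c|^2 |t|^2 with |t|^2 = 1 - z^2, a zero of the determinant. The
other factor is the complex conjugate at a real point.\<close>

lemma den_num_real:
  fixes v :: "coord \<Rightarrow> real"
  assumes v: "v \<in> S_points" and nv: "nonvanishing_on {-1..1} a c"
    and deg: "Polynomial.degree a \<le> m" "Polynomial.degree c \<le> m"
  shows "cx.den m a c (\<lambda>i. complex_of_real (v i)) \<noteq> 0"
    and "cx.num m a c (\<lambda>i. complex_of_real (v i)) \<noteq> 0"
proof -
  define w x where "w = v Cw" and "x = v Cz / v Cw"
  define t where "t = Complex (v Cx) (- v Cy)"
  note S = real_S_point[OF v]
  have w: "complex_of_real w \<noteq> 0" using S by (simp add: w_def)
  have t: "complex_of_real (v Cx) - \<i> * complex_of_real (v Cy) = t"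
    by (simp add: t_def complex_eq_iff)
  have form: "cx.form m q (complex_of_real w) (complex_of_real (v Cz))
      = of_real w ^ m * poly q (of_real x)"
    if "Polynomial.degree q \<le> m" for q
    using form_eq_poly[OF that w, of "complex_of_real (v Cz)"] by (simp add: w_def x_def)
  have "cx.den m a c (\<lambda>i. complex_of_real (v i))
      = of_real w ^ Suc m * (cnj (poly a (of_real x)) + poly c (of_real x) * (t / of_real w))"
    using deg w unfolding cx.den_def t
    by (simp add: form degree_pbar w_def[symmetric] field_simps)
  moreover have "cnj (poly a (of_real x)) + poly c (of_real x) * (t / of_real w) \<noteq> 0"
  proof
    assume "cnj (poly a (of_real x)) + poly c (of_real x) * (t / of_real w) = 0"
    then have e: "cnj (poly a (of_real x)) = - (poly c (of_real x) * (t / of_real w))"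
      by (simp add: eq_neg_iff_add_eq_0)
    have "poly a (of_real x) = - cnj (poly c (of_real x) * (t / of_real w))"
      using arg_cong[OF e, of cnj] by simp
    with e have "poly a (of_real x) * cnj (poly a (of_real x))
        = poly c (of_real x) * cnj (poly c (of_real x)) * ((t / of_real w) * cnj (t / of_real w))"
      by (simp add: algebra_simps)
    also have "(t / of_real w) * cnj (t / of_real w) = of_real ((v Cx / w)\<^sup>2 + (v Cy / w)\<^sup>2)"
      by (simp add: complex_mult_cnj t_def power_divide power2_eq_square add_divide_distrib)
    also have "\<dots> = 1 - (of_real x)\<^sup>2"
      using S(3) by (simp add: w_def x_def)
    finally have "poly (a * pbar a - hpoly * c * pbar c) (of_real x) = 0"
      by (simp add: poly_hpoly)
    moreover have "x \<in> {-1..1}" using S(2) by (simp only: x_def)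
    ultimately show False using nv unfolding nonvanishing_on_def by blast
  qed
  ultimately show den: "cx.den m a c (\<lambda>i. complex_of_real (v i)) \<noteq> 0"
    using w by simp
  have "cx.num m a c (\<lambda>i. complex_of_real (v i)) = cnj (cx.den m a c (\<lambda>i. complex_of_real (v i)))"
    by (simp add: cx.num_def cx.den_def cnj_form pbar_pbar)
  then show "cx.num m a c (\<lambda>i. complex_of_real (v i)) \<noteq> 0"
    using den by simp
qed

lemma of_real_S_points: "v \<in> S_points \<Longrightarrow> (\<lambda>i. complex_of_real (v i)) \<in> S_points"
  by (auto simp: S_points_def simp flip: of_real_power of_real_add)

lemma of_real_ev: "complex_of_real (ev id v p) = ev complex_of_real (\<lambda>i. complex_of_real (v i)) p"
  using ev_natural[of complex_of_real id v p] by simp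

definition base_point :: "coord \<Rightarrow> real" where
  "base_point i = (if i = Cw \<or> i = Cx then 1 else 0)"

lemma base_point_S: "base_point \<in> S_points"
  by (auto simp: S_points_def base_point_def)

lemma family_Cw_real:
  assumes "v \<in> S_points" "nonvanishing_on {-1..1} a c"
    and "Polynomial.degree a \<le> m" "Polynomial.degree c \<le> m"
  shows "ev complex_of_real (\<lambda>i. complex_of_real (v i)) (family m a c Cw) \<noteq> 0"
  using den_num_real[OF assms] real_S_point(1)[OF assms(1)] cx.ev_family(1)[OF refl]
  by simp

text \<open>One representative serves all real points, since its w-coordinate vanishes at none of them.\<close>

lemma family_defined_at:
  assumes "v \<in> S_points" "nonvanishing_on {-1..1} a c"
    and "Polynomial.degree a \<le> m" "Polynomial.degree c \<le> m"
  shows "rational_map UNIV (family m a c)" "defined_at (family m a c) v"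
proof -
  show r: "rational_map UNIV (family m a c)"
    unfolding rational_map_def
    using homogeneous_family of_real_S_points[OF assms(1)] family_Cw_real[OF assms] by blast
  have "ev id v (family m a c Cw) \<noteq> 0"
    using family_Cw_real[OF assms] by (auto simp flip: of_real_ev)
  with r show "defined_at (family m a c) v"
    by (auto simp: defined_at_def same_map_def algebra_simps)
qed

lemma family_selfmap:
  assumes "nonvanishing_on {-1..1} a c"
    and "Polynomial.degree a \<le> m" "Polynomial.degree c \<le> m"
  shows "rational_selfmap (family m a c)"
  unfolding rational_selfmap_def
proof (intro conjI ballI impI)
  show "rational_map UNIV (family m a c)"
    by (rule family_defined_at(1)[OF base_point_S assms])
  fix v :: "coord \<Rightarrow> complex"
  assume v: "v \<in> S_points" and "\<exists>i. ev complex_of_real v (family m a c i) \<noteq> 0"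
  then obtain i where i: "ev complex_of_real v (family m a c i) \<noteq> 0" by auto
  note e = cx.ev_family[OF refl, of v m a c]
  show "(\<lambda>i. ev complex_of_real v (family m a c i)) \<in> S_points"
  proof (rule S_pointI[where i = i])
    show "ev complex_of_real v (family m a c i) \<noteq> 0" by (fact i)
    show "(ev complex_of_real v (family m a c Cx) - \<i> * ev complex_of_real v (family m a c Cy)) *
      (ev complex_of_real v (family m a c Cx) + \<i> * ev complex_of_real v (family m a c Cy)) =
      (ev complex_of_real v (family m a c Cw))\<^sup>2 - (ev complex_of_real v (family m a c Cz))\<^sup>2"
    proof -
      have "(v Cx - \<i> * v Cy) * (v Cx + \<i> * v Cy) * (cx.den m a c v * cx.num m a c v)\<^sup>2
          = ((v Cw)\<^sup>2 - (v Cz)\<^sup>2) * (cx.den m a c v * cx.num m a c v)\<^sup>2"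
        by (simp only: S_point_product[OF v])
      then show ?thesis unfolding e by (simp add: power2_eq_square algebra_simps)
    qed
  qed
qed

lemma family_comp:
  assumes "nonvanishing_on {-1..1} a c"
    and "Polynomial.degree a \<le> m" "Polynomial.degree c \<le> m"
  shows "rational_map UNIV (comp_map (family m a c) (family m (pbar a) (- c)))"
    and "same_map UNIV (comp_map (family m a c) (family m (pbar a) (- c))) Var"
proof -
  show "same_map UNIV (comp_map (family m a c) (family m (pbar a) (- c))) Var"
    by (simp add: same_map_def ev_family_comp cx.ev_Var)
  define v where "v = (\<lambda>i. complex_of_real (base_point i))"
  have v: "v \<in> S_points" "v Cw = 1" "v Cz = 0"
    using of_real_S_points[OF base_point_S] by (simp_all add: v_def base_point_def)
  have dn: "cx.den m (pbar a) (- c) v \<noteq> 0" "cx.num m (pbar a) (- c) v \<noteq> 0"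
    unfolding v_def
    using den_num_real[OF base_point_S, of "pbar a" "- c" m] assms
    by (simp_all add: nonvanishing_on_inverse degree_pbar)
  have form: "cx.form m q 1 0 = poly q 0" if "Polynomial.degree q \<le> m" for q
    using form_eq_poly[OF that, of 1 0] by simp
  have "poly (a * pbar a - hpoly * c * pbar c) (complex_of_real 0) \<noteq> 0"
    using assms(1) by (simp add: nonvanishing_on_def del: of_real_0)
  then have "ev complex_of_real v (comp_map (family m a c) (family m (pbar a) (- c)) Cw) \<noteq> 0"
    using dn assms by (simp add: ev_family_comp v form degree_pbar poly_hpoly)
  then show "rational_map UNIV (comp_map (family m a c) (family m (pbar a) (- c)))"
    unfolding rational_map_def
    using v(1) homogeneous_comp_map[where F = "family m a c" and G = "family m (pbar a) (- c)",
        OF homogeneous_family homogeneous_family] by blast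
qed

lemma family_in_Aut:
  assumes "nonvanishing_on {-1..1} a c"
    and "Polynomial.degree a \<le> m" "Polynomial.degree c \<le> m"
  shows "family m a c \<in> Aut_S_pi"
proof -
  have inv: "nonvanishing_on {-1..1} (pbar a) (- c)" "Polynomial.degree (pbar a) \<le> m"
    "Polynomial.degree (- c) \<le> m"
    using assms by (simp_all add: nonvanishing_on_inverse degree_pbar)
  have "rational_map {Cw, Cz} (family m a c)"
    unfolding rational_map_def
    using homogeneous_family of_real_S_points[OF base_point_S]
      family_Cw_real[OF base_point_S assms] by blast
  moreover have "same_map {Cw, Cz} (family m a c) Var"
    using cx.ev_family(1,2)[OF refl, of _ m a c] by (auto simp: same_map_def cx.ev_Var)
  moreover have "inverse_maps (family m a c) (family m (pbar a) (- c))"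
    using family_comp[OF assms] family_comp[OF inv] by (simp add: inverse_maps_def pbar_pbar)
  ultimately show ?thesis
    unfolding Aut_S_pi_def preserves_pi_def
    using family_selfmap[OF assms] family_selfmap[OF inv] family_defined_at(2)[OF _ assms]
      family_defined_at(2)[OF _ inv] by blast
qed


section \<open>The matrix of the automorphism\<close>

lemma Cz_const_conv: "Cz_const c = to_fract [:c:]"
  by (simp add: Cz_const_def to_fract_def)

lemma Cz_embed_conv: "Cz_embed a = to_fract [:a:]"
  by (simp add: Cz_embed_def to_fract_def)

lemma gen_t_conv: "gen_t = to_fract [:0, 1:]"
  by (simp add: gen_t_def to_fract_def)

lemma gen_z_conv: "gen_z = Cz_embed (to_fract [:0, 1:])"
  by (simp add: gen_z_def to_fract_def)

lemma Cz_embed_hom: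
  "Cz_embed (a + b) = Cz_embed a + Cz_embed b" "Cz_embed (a * b) = Cz_embed a * Cz_embed b"
  "Cz_embed 1 = 1" "Cz_embed 0 = 0" "Cz_embed (- a) = - Cz_embed a"
  "Cz_embed (a - b) = Cz_embed a - Cz_embed b"
  by (simp_all add: Cz_embed_conv flip: to_fract_add to_fract_mult to_fract_uminus to_fract_diff one_pCons)

lemma Cz_embed_linear_eq_0_iff:
  "Cz_embed a * gen_t + Cz_embed b = 0 \<longleftrightarrow> a = 0 \<and> b = 0"
proof -
  have "Cz_embed a * gen_t + Cz_embed b = to_fract [:b, a:]"
    by (simp add: Cz_embed_conv gen_t_conv flip: to_fract_mult to_fract_add)
  then show ?thesis by auto
qed

interpretation kx: complex_structure K_const
  by unfold_locales (simp_all add: K_const_hom)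

text \<open>On w = 1 and at the generic z, the homogenized polynomial is the polynomial itself, seen in \<complex>(z).\<close>

lemma K_form:
  assumes "Polynomial.degree a \<le> m"
  shows "kx.form m a 1 gen_z = Cz_embed (to_fract a)"
proof -
  have power: "Cz_embed x ^ k = Cz_embed (x ^ k)" for x k
    by (induction k) (simp_all add: Cz_embed_hom)
  have fpower: "to_fract p ^ k = to_fract (p ^ k)" for p :: "complex poly" and k
    by (induction k) simp_all
  have sum: "(\<Sum>k\<in>A. Cz_embed (f k)) = Cz_embed (sum f A)" for f :: "nat \<Rightarrow> Cz_field" and A
    by (induction A rule: infinite_finite_induct) (simp_all add: Cz_embed_hom)
  have "kx.form m a 1 gen_z =
      (\<Sum>k\<le>m. Cz_embed (to_fract ([:poly.coeff a k:] * [:0, 1:] ^ k)))"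
    unfolding kx.form_def gen_z_conv power fpower K_const_def Cz_const_conv
    by (simp only: Cz_embed_hom to_fract_mult power_one mult_1_left)
  also have "\<dots> = Cz_embed (to_fract (\<Sum>k\<le>m. Polynomial.monom (poly.coeff a k) k))"
    by (simp add: sum monom_altdef)
  finally show ?thesis
    using assms by (simp add: poly_as_sum_of_monoms')
qed

text \<open>Since t u = h, the quotient t (a + cbar u) / (abar + c t) equals (a t + h cbar) / (c t + abar).\<close>

lemma psi_conj_family:
  assumes deg: "Polynomial.degree a \<le> m" "Polynomial.degree c \<le> m" and nz: "a \<noteq> 0 \<or> c \<noteq> 0"
  shows "psi_conj (family m a c) = moebius (mat2 (to_fract a) (to_fract (hpoly * pbar c))
    (to_fract c) (to_fract (pbar a)))"
proof -
  define v where "v = psi_inv (gen_t, gen_z)"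
  define e where "e = (\<lambda>q. Cz_embed (to_fract q))"
  have t0: "gen_t \<noteq> 0" by (simp add: gen_t_conv)
  have w: "v Cw = 1" and z: "v Cz = gen_z" by (simp_all add: v_def psi_inv_def)
  have t: "v Cx - K_const \<i> * v Cy = gen_t"
    using psi_psi_inv[of gen_t gen_z] by (simp add: psi_def w flip: v_def)
  define u where "u = v Cx + K_const \<i> * v Cy"
  have "(v Cw)\<^sup>2 = (v Cx)\<^sup>2 + (v Cy)\<^sup>2 + (v Cz)\<^sup>2"
    using psi_inv_in_S[OF t0, of gen_z] by (simp add: S_points_def flip: v_def)
  moreover have "(v Cx - K_const \<i> * v Cy) * u = (v Cx)\<^sup>2 - (K_const \<i> * K_const \<i>) * (v Cy)\<^sup>2"
    by (simp add: u_def algebra_simps power2_eq_square)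
  ultimately have tu: "gen_t * u = 1 - gen_z\<^sup>2"
    unfolding t kx.i_squared by (simp add: w z algebra_simps)
  have hz: "1 - gen_z\<^sup>2 = e hpoly"
    using K_form[of hpoly 2]
    by (simp add: e_def hpoly_def kx.form_def numeral_2_eq_2 kx.const_one kx.const_uminus kx.zero K_const_hom)
  have D: "kx.den m a c v = e c * gen_t + e (pbar a)"
    unfolding kx.den_def t using deg by (simp add: w z K_form degree_pbar e_def)
  have N: "kx.num m a c v * gen_t = e a * gen_t + e (hpoly * pbar c)"
    unfolding kx.num_def u_def[symmetric] using deg tu
    by (simp add: w z K_form degree_pbar e_def Cz_embed_hom hz[unfolded e_def] algebra_simps)
  have D0: "kx.den m a c v \<noteq> 0"
    unfolding D e_def Cz_embed_linear_eq_0_iff using nz by (auto simp: map_poly_eq_0_iff)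
  have "hpoly \<noteq> 0" by (simp add: hpoly_def)
  then have "kx.num m a c v * gen_t \<noteq> 0"
    unfolding N e_def Cz_embed_linear_eq_0_iff using nz by (auto simp: map_poly_eq_0_iff)
  then have N0: "kx.num m a c v \<noteq> 0" by auto
  define G where "G = (\<lambda>i. ev (\<lambda>r. K_const (complex_of_real r)) v (family m a c i))"
  note G = kx.ev_family[where G = G, OF fun_cong[OF G_def], unfolded t w z]
  have "psi_conj (family m a c) = ((G Cx - K_const \<i> * G Cy) / G Cw, G Cz / G Cw)"
    by (simp add: psi_conj_def psi_def G_def v_def diff_divide_distrib)
  also have "\<dots> = ((kx.num m a c v * gen_t) / kx.den m a c v, gen_z)"
    unfolding G using D0 N0 by (simp add: field_simps)
  finally show ?thesis
    by (simp add: moebius_def D N e_def)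
qed

lemma in_H_groupI:
  assumes "nonvanishing_on {-1..1} a c"
  shows "proj (mat2 (to_fract a) (to_fract (hpoly * pbar c)) (to_fract c) (to_fract (pbar a)))
    \<in> H_group"
proof -
  let ?m = "max (Polynomial.degree a) (Polynomial.degree c)"
  let ?M = "mat2 (to_fract a) (to_fract (hpoly * pbar c)) (to_fract c) (to_fract (pbar a))"
  have "poly (a * pbar a - hpoly * c * pbar c) (complex_of_real 0) \<noteq> 0"
    using assms by (simp add: nonvanishing_on_def del: of_real_0)
  then have det: "a * pbar a - hpoly * c * pbar c \<noteq> 0" by force
  then have nz: "a \<noteq> 0 \<or> c \<noteq> 0" by auto
  have "to_fract a * to_fract (pbar a) - to_fract (hpoly * pbar c) * to_fract c
      = to_fract (a * pbar a - hpoly * c * pbar c)"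
    by (simp add: algebra_simps)
  also have "\<dots> \<noteq> 0" using det by (simp only: to_fract_eq_0_iff not_False_eq_True)
  finally have "invertible ?M" by (subst invertible_mat2)
  moreover have "psi_conj (family ?m a c) = moebius ?M"
    by (rule psi_conj_family) (use nz in auto)
  moreover have "family ?m a c \<in> Aut_S_pi"
    by (rule family_in_Aut) (use assms in auto)
  ultimately show ?thesis
    unfolding H_group_def using proj_in_PGL2 in_proj_self by blast
qed

section \<open>Pullback to the plane and density of real points\<close>
definition const2 :: "complex \<Rightarrow> complex poly poly" where
  "const2 a = [:[:a:]:]"

interpretation px: complex_structure const2
  by unfold_locales (simp_all add: const2_def one_pCons)

text \<open>Polynomials in z are the coefficients, t is the outer variable.\<close>

definition eval2 :: "complex poly poly \<Rightarrow> complex \<Rightarrow> complex \<Rightarrow> complex" where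
  "eval2 q t z = poly (poly q [:t:]) z"

lemma eval2_hom:
  "eval2 (p + q) t z = eval2 p t z + eval2 q t z" "eval2 (p - q) t z = eval2 p t z - eval2 q t z"
  "eval2 (p * q) t z = eval2 p t z * eval2 q t z" "eval2 0 t z = 0" "eval2 1 t z = 1"
  "eval2 (p ^ n) t z = eval2 p t z ^ n" "eval2 (const2 k) t z = k"
  "eval2 [:b, a:] t z = poly a z * t + poly b z" "eval2 [:b:] t z = poly b z"
  by (simp_all add: eval2_def const2_def algebra_simps)

lemma infinite_circle:
  assumes "r > 0"
  shows "infinite {t. (cmod t)\<^sup>2 = r}"
proof -
  have "(\<lambda>x. Complex x (sqrt (r - x\<^sup>2))) ` {0..sqrt r} \<subseteq> {t. (cmod t)\<^sup>2 = r}"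
  proof clarsimp
    fix x assume x: "0 \<le> x" "x \<le> sqrt r"
    have "x\<^sup>2 \<le> (sqrt r)\<^sup>2" using x by (intro power_mono)
    then have "x\<^sup>2 \<le> r" using assms by simp
    then show "(cmod (Complex x (sqrt (r - x\<^sup>2))))\<^sup>2 = r" by (simp add: cmod_power2)
  qed
  moreover have "inj_on (\<lambda>x. Complex x (sqrt (r - x\<^sup>2))) {0..sqrt r}"
    by (auto simp: inj_on_def)
  moreover have "infinite {0..sqrt r}" using assms by simp
  ultimately show ?thesis by (meson finite_imageD infinite_super)
qed

text \<open>The real points with z in (-1, 1) are Zariski dense in the (t, z) plane: each of infinitely many z
has a whole circle of them. All polynomial identities below are checked on these points.\<close>

lemma eval2_eq_0_real_points:
  assumes "\<And>t z. -1 < z \<Longrightarrow> z < 1 \<Longrightarrow> (cmod t)\<^sup>2 = 1 - z\<^sup>2 \<Longrightarrow> eval2 q t (complex_of_real z) = 0"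
  shows "q = 0"
proof (rule poly_eqI)
  fix n
  have "poly (poly.coeff q n) (complex_of_real z) = 0" if z: "z \<in> {-1<..<1}" for z
  proof -
    have "z\<^sup>2 < 1" using z by (simp add: abs_square_less_1 abs_less_iff)
    then have inf: "infinite {t. (cmod t)\<^sup>2 = 1 - z\<^sup>2}" by (intro infinite_circle) simp
    define r where "r = map_poly (\<lambda>c. poly c (complex_of_real z)) q"
    have "poly r t = eval2 q t (complex_of_real z)" for t
      unfolding r_def eval2_def
      by (induction q) (simp_all add: map_poly_pCons)
    then have "{t. (cmod t)\<^sup>2 = 1 - z\<^sup>2} \<subseteq> {t. poly r t = 0}"
      using assms z by auto
    then have "r = 0" using inf poly_roots_finite infinite_super by blast
    then have "poly.coeff r n = 0" by simp
    then show ?thesis by (simp add: r_def coeff_map_poly)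
  qed
  then have "complex_of_real ` {-1<..<1} \<subseteq> {z. poly (poly.coeff q n) z = 0}" by auto
  moreover have "infinite (complex_of_real ` {-1<..<1})"
  proof
    assume "finite (complex_of_real ` {-1<..<1})"
    then have "finite {-1<..<(1::real)}" by (rule finite_imageD) (simp add: inj_on_def)
    then show False by (simp add: infinite_Ioo)
  qed
  ultimately have "infinite {z. poly (poly.coeff q n) z = 0}"
    by (rule infinite_super)
  then show "poly.coeff q n = poly.coeff 0 n"
    using poly_roots_finite[of "poly.coeff q n"] by auto
qed

text \<open>The inverse of psi multiplied by 2 t, which makes its coordinates polynomials in t and z.\<close>

definition param :: "coord \<Rightarrow> complex poly poly" where
  "param i = (case i of
       Cw \<Rightarrow> 2 * [:0, 1:]
     | Cx \<Rightarrow> [:0, 1:]\<^sup>2 + [:hpoly:]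
     | Cy \<Rightarrow> const2 \<i> * ([:0, 1:]\<^sup>2 - [:hpoly:])
     | Cz \<Rightarrow> 2 * [:0, 1:] * [:[:0, 1:]:])"

definition pull :: "rpoly \<Rightarrow> complex poly poly" where
  "pull p = ev (\<lambda>r. const2 (complex_of_real r)) param p"

lemma eval2_two: "eval2 2 t z = 2"
  using eval2_hom(1)[of 1 1 t z] by (simp add: eval2_hom)

lemma eval2_param:
  "eval2 (param Cw) t z = 2 * t" "eval2 (param Cx) t z = t\<^sup>2 + (1 - z\<^sup>2)"
  "eval2 (param Cy) t z = \<i> * (t\<^sup>2 - (1 - z\<^sup>2))" "eval2 (param Cz) t z = 2 * t * z"
  by (simp_all only: param_def coord.case eval2_hom poly_hpoly eval2_two) simp_all

lemma eval2_param_S: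
  assumes "t \<noteq> 0"
  shows "(\<lambda>i. eval2 (param i) t z) \<in> S_points"
proof (rule S_pointI[where i = Cw])
  show "eval2 (param Cw) t z \<noteq> 0" using assms by (simp add: eval2_param)
qed (simp add: eval2_param algebra_simps power2_eq_square)

lemma eval2_ev:
  "eval2 (ev (\<lambda>r. const2 (complex_of_real r)) f p) t z = ev complex_of_real (\<lambda>i. eval2 (f i) t z) p"
  using ev_natural[of "\<lambda>q. eval2 q t z" "\<lambda>r. const2 (complex_of_real r)" f p]
  by (simp add: eval2_hom)

lemma eval2_pull: "eval2 (pull p) t z = ev complex_of_real (\<lambda>i. eval2 (param i) t z) p"
  by (simp add: pull_def eval2_ev)

definition real_point :: "complex \<Rightarrow> real \<Rightarrow> coord \<Rightarrow> real" where
  "real_point t z i = (case i of Cw \<Rightarrow> 1 | Cx \<Rightarrow> Re t | Cy \<Rightarrow> - Im t | Cz \<Rightarrow> z)"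

lemma real_point_S:
  assumes "(cmod t)\<^sup>2 = 1 - z\<^sup>2"
  shows "real_point t z \<in> S_points"
  using assms by (auto simp: S_points_def real_point_def cmod_power2 intro!: exI[of _ Cw])

lemma eval2_param_real:
  assumes "(cmod t)\<^sup>2 = 1 - z\<^sup>2"
  shows "eval2 (param i) t (complex_of_real z) = 2 * t * complex_of_real (real_point t z i)"
proof -
  have "1 - (complex_of_real z)\<^sup>2 = complex_of_real ((cmod t)\<^sup>2)"
    unfolding assms by simp
  also have "\<dots> = t * cnj t" by (rule complex_norm_square)
  finally have h: "1 - (complex_of_real z)\<^sup>2 = t * cnj t" .
  have s: "t\<^sup>2 + t * cnj t = 2 * t * complex_of_real (Re t)"
    using complex_add_cnj[of t] by (simp add: power2_eq_square flip: distrib_left)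
  have d: "t\<^sup>2 - t * cnj t = 2 * t * (\<i> * complex_of_real (Im t))"
    using complex_diff_cnj[of t] by (simp add: power2_eq_square flip: right_diff_distrib)
  show ?thesis
    by (cases i; simp only: eval2_param h s d real_point_def coord.case) simp_all
qed

lemma eval2_pull_real:
  assumes "homogeneous d p" "(cmod t)\<^sup>2 = 1 - z\<^sup>2"
  shows "eval2 (pull p) t (complex_of_real z) = (2 * t) ^ d * complex_of_real (ev id (real_point t z) p)"
  using ev_homogeneous[OF assms(1), where \<phi> = complex_of_real and k = "2 * t"]
  by (simp add: eval2_pull eval2_param_real[OF assms(2)] of_real_ev)

lemma rank_one_factorisation:
  fixes p q r s :: complex
  assumes "p * s = q * r"
  obtains a1 a2 b1 b2 where "p = a1 * b1" "q = a1 * b2" "r = a2 * b1" "s = a2 * b2"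
proof (cases "p = 0")
  case False
  then show ?thesis
    using assms that[of 1 p q "r / p"] by (simp add: field_simps)
next
  case p: True
  then consider "q = 0" | "q \<noteq> 0" "r = 0" using assms by auto
  then show ?thesis
  proof cases
    case 1
    then show ?thesis using p that[of 0 r s 1] by simp
  next
    case 2
    then show ?thesis using p that[of q 0 1 s] by simp
  qed
qed

text \<open>A form that is nonzero somewhere on S stays nonzero after pullback, although the parametrisation
misses the points of S with w = 0 or t = 0: S is the Segre quadric t u = (w - z)(w + z), so its points
are products of two vectors, and a line in the space of these vectors leads from any point to parametrised
ones.\<close>

lemma pull_nonzero:
  assumes hom: "homogeneous d p" and v: "v \<in> S_points" and nz: "ev complex_of_real v p \<noteq> 0"
  shows "pull p \<noteq> 0"
proof
  assume pull: "pull p = 0"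
  have chart: "ev complex_of_real y p = 0"
    if y: "y \<in> S_points" "y Cw \<noteq> 0" "y Cx - \<i> * y Cy \<noteq> 0" for y :: "coord \<Rightarrow> complex"
  proof -
    define t where "t = (y Cx - \<i> * y Cy) / y Cw"
    define z where "z = y Cz / y Cw"
    define k where "k = y Cw / (2 * t)"
    have t: "t \<noteq> 0" using y by (simp add: t_def)
    define u where "u = (y Cx + \<i> * y Cy) / y Cw"
    have tu: "1 - z\<^sup>2 = t * u"
      using S_point_product[OF y(1)] y(2) by (simp add: t_def u_def z_def field_simps power2_eq_square)
    have k: "k * t = y Cw / 2" using t by (simp add: k_def)
    have ut: "t + u = 2 * y Cx / y Cw" "t - u = - (2 * \<i> * y Cy / y Cw)"
      unfolding t_def u_def by (simp_all flip: add_divide_distrib diff_divide_distrib)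
    have "y i = k * eval2 (param i) t z" for i
    proof (cases i)
      case Cw
      have "k * eval2 (param Cw) t z = 2 * (k * t)"
        by (simp add: eval2_param)
      then show ?thesis by (simp add: k Cw)
    next
      case Cx
      have "k * eval2 (param Cx) t z = (k * t) * (t + u)"
        unfolding eval2_param tu by (simp add: distrib_left power2_eq_square)
      then show ?thesis using y(2) by (simp add: k ut Cx)
    next
      case Cy
      have "k * eval2 (param Cy) t z = (k * t) * (\<i> * (t - u))"
        unfolding eval2_param tu by (simp add: right_diff_distrib power2_eq_square)
      then show ?thesis using y(2) by (simp add: k ut Cy)
    next
      case Cz
      have "k * eval2 (param Cz) t z = 2 * (k * t) * z"
        by (simp add: eval2_param)
      then show ?thesis using y(2) by (simp add: k Cz z_def)
    qed
    then have "y = (\<lambda>i. k * eval2 (param i) t z)" by auto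
    then have "ev complex_of_real y p = k ^ d * eval2 (pull p) t z"
      by (simp add: ev_homogeneous[OF hom] eval2_pull)
    then show ?thesis by (simp add: pull eval2_hom)
  qed
  (* The Segre factorisation of v. *)
  obtain a1 a2 b1 b2 where ab: "v Cx - \<i> * v Cy = a1 * b1" "v Cw - v Cz = a1 * b2"
    "v Cw + v Cz = a2 * b1" "v Cx + \<i> * v Cy = a2 * b2"
  proof (rule rank_one_factorisation)
    show "(v Cx - \<i> * v Cy) * (v Cx + \<i> * v Cy) = (v Cw - v Cz) * (v Cw + v Cz)"
      using S_point_product[OF v] by (simp add: algebra_simps power2_eq_square)
  qed
  (* Adding the variable s to all four entries gives a curve on S through v on which w and t are
     nonzero polynomials: both have degree 2 in s. *)
  define A1 A2 B1 B2 where "A1 = [:a1, 1:]" and "A2 = [:a2, 1:]"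
    and "B1 = [:b1, 1:]" and "B2 = [:b2, 1:]"
  define P where "P = (\<lambda>i. case i of
       Cw \<Rightarrow> Polynomial.smult (1/2) (A1 * B2 + A2 * B1)
     | Cx \<Rightarrow> Polynomial.smult (1/2) (A1 * B1 + A2 * B2)
     | Cy \<Rightarrow> Polynomial.smult (\<i>/2) (A1 * B1 - A2 * B2)
     | Cz \<Rightarrow> Polynomial.smult (1/2) (A2 * B1 - A1 * B2))"
  define q where "q = ev (\<lambda>r. [:complex_of_real r:]) P p"
  have q: "poly q s = ev complex_of_real (\<lambda>i. poly (P i) s) p" for s
    unfolding q_def using ev_natural[of "\<lambda>r. poly r s" "\<lambda>r. [:complex_of_real r:]" P p] by simp
  have tu: "poly (P Cx) s - \<i> * poly (P Cy) s = poly (A1 * B1) s"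
    "poly (P Cx) s + \<i> * poly (P Cy) s = poly (A2 * B2) s" for s
    by (simp_all add: P_def field_simps)
  have "poly (q * (P Cw * (A1 * B1))) s = 0" for s
  proof (cases "poly (P Cw) s = 0 \<or> poly (A1 * B1) s = 0")
    case False
    have "(\<lambda>i. poly (P i) s) \<in> S_points"
    proof (rule S_pointI[where i = Cw])
      show "(poly (P Cx) s - \<i> * poly (P Cy) s) * (poly (P Cx) s + \<i> * poly (P Cy) s)
          = (poly (P Cw) s)\<^sup>2 - (poly (P Cz) s)\<^sup>2"
        unfolding tu by (simp add: P_def field_simps power2_eq_square)
    qed (use False in auto)
    then have "poly q s = 0" unfolding q using False tu[of s] by (intro chart) auto
    then show ?thesis by simp
  qed auto
  then have "q * (P Cw * (A1 * B1)) = 0"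
    using poly_all_0_iff_0 by blast
  moreover have "A1 \<noteq> 0" "B1 \<noteq> 0" by (simp_all add: A1_def B1_def)
  moreover have "P Cw \<noteq> 0"
  proof -
    have "poly.coeff (P Cw) 2 = 1"
      by (simp add: P_def A1_def A2_def B1_def B2_def numeral_2_eq_2)
    then show ?thesis by auto
  qed
  ultimately have "q = 0" by simp
  moreover have "poly (P i) 0 = v i" for i
  proof -
    have P: "poly (P Cw) 0 = (a1 * b2 + a2 * b1) / 2" "poly (P Cx) 0 = (a1 * b1 + a2 * b2) / 2"
      "poly (P Cy) 0 = \<i> * (a1 * b1 - a2 * b2) / 2" "poly (P Cz) 0 = (a2 * b1 - a1 * b2) / 2"
      by (simp_all add: P_def A1_def A2_def B1_def B2_def)
    show ?thesis
      by (cases i; simp only: P ab[symmetric]) (simp_all add: field_simps)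
  qed
  ultimately have "ev complex_of_real v p = 0" using q[of 0] by simp
  with nz show False by simp
qed


definition to_K :: "complex poly poly \<Rightarrow> K_field" where
  "to_K q = to_fract (map_poly to_fract q)"

lemma to_K_hom:
  "to_K (p + q) = to_K p + to_K q" "to_K (p - q) = to_K p - to_K q"
  "to_K (p * q) = to_K p * to_K q" "to_K 1 = 1" "to_K 0 = 0"
  by (simp_all add: to_K_def)

lemma to_K_eq_iff: "to_K p = to_K q \<longleftrightarrow> p = q"
  by (simp add: to_K_def)

lemma to_K_linear: "to_K [:b, a:] = Cz_embed (to_fract a) * gen_t + Cz_embed (to_fract b)"
  by (simp add: to_K_def Cz_embed_conv gen_t_conv map_poly_pCons flip: to_fract_mult to_fract_add)

lemma to_K_const: "to_K [:b:] = Cz_embed (to_fract b)"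
  using to_K_linear[of b 0] by (simp add: Cz_embed_hom)

lemma to_K_two: "to_K 2 = 2"
  using to_K_hom(1)[of 1 1] by (simp add: to_K_hom)

lemma two_K: "(2 :: K_field) \<noteq> 0"
  using to_K_eq_iff[of 2 0] by (simp add: to_K_two to_K_hom)

lemma to_K_param:
  "to_K (param i) = (2 * gen_t) * psi_inv (gen_t, gen_z) i"
proof -
  have t: "to_K [:0, 1:] = gen_t" using to_K_linear[of 0 1] by (simp add: Cz_embed_hom)
  have z: "to_K [:[:0, 1:]:] = gen_z" by (simp add: to_K_const gen_z_conv)
  have t0: "gen_t \<noteq> 0" by (simp add: gen_t_conv)
  have "hpoly = 1 - [:0, 1:] * [:0, 1:]" by (simp add: hpoly_def one_pCons)
  then have "[:hpoly:] = 1 - [:[:0, 1:]:] * [:[:0, 1:]:]"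
    by (simp add: one_pCons)
  then have h: "to_K [:hpoly:] = 1 - gen_z\<^sup>2"
    by (simp only: to_K_hom z power2_eq_square)
  have c: "to_K (const2 a) = K_const a" for a
    by (simp add: const2_def to_K_const K_const_def Cz_const_conv)
  have half: "2 * K_const (1/2) = 1" "2 * K_const (\<i>/2) = K_const \<i>"
    by (simp_all only: mult_2 K_const_hom) (simp_all add: K_const_hom)
  define s where "s = (1 - gen_z\<^sup>2) / gen_t"
  have ts: "gen_t * s = 1 - gen_z\<^sup>2" using t0 by (simp add: s_def)
  show ?thesis
  proof (cases i)
    case Cx
    have "2 * gen_t * psi_inv (gen_t, gen_z) Cx = (2 * K_const (1/2)) * (gen_t * (gen_t + s))"
      by (simp add: psi_inv_def s_def)
    also have "\<dots> = gen_t * gen_t + (1 - gen_z\<^sup>2)"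
      by (simp only: half distrib_left ts mult_1_left)
    finally show ?thesis by (simp only: Cx param_def coord.case to_K_hom t h power2_eq_square)
  next
    case Cy
    have "2 * gen_t * psi_inv (gen_t, gen_z) Cy = (2 * K_const (\<i>/2)) * (gen_t * (gen_t - s))"
      by (simp add: psi_inv_def s_def)
    also have "\<dots> = K_const \<i> * (gen_t * gen_t - (1 - gen_z\<^sup>2))"
      by (simp only: half right_diff_distrib ts)
    finally show ?thesis by (simp only: Cy param_def coord.case to_K_hom t h c power2_eq_square)
  qed (simp_all only: param_def coord.case to_K_hom t z to_K_two, simp_all add: psi_inv_def)
qed

text \<open>Forms evaluated at the generic point of the plane, up to the factor by which the parametrisation was scaled.\<close>

lemma to_K_pull:
  assumes "homogeneous d p"
  shows "to_K (pull p) = (2 * gen_t) ^ d *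
    ev (\<lambda>r. K_const (complex_of_real r)) (psi_inv (gen_t, gen_z)) p"
proof -
  have "to_K (pull p) = ev (\<lambda>r. K_const (complex_of_real r)) (\<lambda>i. to_K (param i)) p"
    unfolding pull_def
    by (subst ev_natural[where \<eta> = to_K])
      (simp_all add: to_K_hom const2_def to_K_const K_const_def Cz_const_conv)
  then show ?thesis by (simp add: to_K_param ev_homogeneous[OF assms])
qed

text \<open>The hypothesis on \<open>psi_conj\<close>, an identity of rational functions, with denominators cleared.\<close>

lemma moebius_identity:
  assumes hom: "\<And>i. homogeneous d (F i)"
    and psi: "psi_conj F = moebius (mat2 (to_fract a) (to_fract b) (to_fract c) (to_fract e))"
    and inv: "c \<noteq> 0 \<or> e \<noteq> 0"
  shows "pull (F Cw) \<noteq> 0" "pull (F Cz) = [:[:0, 1:]:] * pull (F Cw)"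
    "(pull (F Cx) - const2 \<i> * pull (F Cy)) * [:e, c:] = pull (F Cw) * [:b, a:]"
proof -
  define g where "g = (2 * gen_t) ^ d"
  define G where "G = (\<lambda>i. ev (\<lambda>r. K_const (complex_of_real r)) (psi_inv (gen_t, gen_z)) (F i))"
  have "(2 * gen_t :: K_field) \<noteq> 0" by (simp add: gen_t_conv two_K)
  then have g: "g \<noteq> 0" by (simp add: g_def)
  have f: "to_K (pull (F i)) = g * G i" for i
    by (simp add: to_K_pull[OF hom] g_def G_def)
  have psi_G: "psi_conj F = (G Cx / G Cw - K_const \<i> * (G Cy / G Cw), G Cz / G Cw)"
    by (simp add: psi_conj_def psi_def G_def)
  have 1: "G Cz / G Cw = gen_z" using psi psi_G by (simp add: moebius_def)
  have 2: "G Cx / G Cw - K_const \<i> * (G Cy / G Cw) = to_K [:b, a:] / to_K [:e, c:]"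
    using psi psi_G by (simp add: moebius_def to_K_linear)
  have z: "gen_z = to_K [:[:0, 1:]:]" by (simp add: to_K_const gen_z_conv)
  have z0: "gen_z \<noteq> 0" using to_K_eq_iff[of "[:[:0, 1:]:]" 0] by (simp add: z to_K_hom)
  then have w: "G Cw \<noteq> 0" using 1 by auto
  then have "to_K (pull (F Cw)) \<noteq> 0" using g by (simp add: f)
  then show "pull (F Cw) \<noteq> 0" by (auto simp: to_K_hom)
  have "to_K (pull (F Cz)) = to_K ([:[:0, 1:]:] * pull (F Cw))"
  proof -
    have "G Cz = gen_z * G Cw" using 1 w by (simp add: nonzero_divide_eq_eq)
    then show ?thesis by (simp only: to_K_hom z[symmetric] f mult.left_commute)
  qed
  then show "pull (F Cz) = [:[:0, 1:]:] * pull (F Cw)" by (simp only: to_K_eq_iff)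
  have "to_K [:e, c:] \<noteq> 0" using inv to_K_eq_iff[of "[:e, c:]" 0] by (auto simp: to_K_hom)
  then have "(G Cx - K_const \<i> * G Cy) * to_K [:e, c:] = G Cw * to_K [:b, a:]"
    using 2 w by (simp add: field_simps)
  then have "g * ((G Cx - K_const \<i> * G Cy) * to_K [:e, c:]) = g * (G Cw * to_K [:b, a:])"
    by simp
  moreover have "to_K (const2 \<i>) = K_const \<i>"
    by (simp add: const2_def to_K_const K_const_def Cz_const_conv)
  ultimately have "to_K ((pull (F Cx) - const2 \<i> * pull (F Cy)) * [:e, c:]) = to_K (pull (F Cw) * [:b, a:])"
    by (simp only: to_K_hom f) (simp add: algebra_simps)
  then show "(pull (F Cx) - const2 \<i> * pull (F Cy)) * [:e, c:] = pull (F Cw) * [:b, a:]"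
    by (simp only: to_K_eq_iff)
qed

section \<open>Reality and the normal form of the matrix\<close>
lemma eval2_eqI:
  assumes "\<And>t z. t \<noteq> 0 \<Longrightarrow> eval2 p t z = eval2 q t z"
  shows "p = q"
proof -
  have "p - q = 0"
  proof (rule eval2_eq_0_real_points)
    fix t :: complex and z :: real
    assume "-1 < z" "z < 1" "(cmod t)\<^sup>2 = 1 - z\<^sup>2"
    moreover from this have "z\<^sup>2 < 1" by (simp add: abs_square_less_1 abs_less_iff)
    ultimately have "t \<noteq> 0" by auto
    then show "eval2 (p - q) t (complex_of_real z) = 0" by (simp add: eval2_hom assms)
  qed
  then show ?thesis by simp
qed

lemma finite_eval2_zeros:
  assumes "eval2 q t0 z \<noteq> 0"
  shows "finite {t. eval2 q t z = 0}"
proof -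
  (* The polynomial q as a polynomial in t alone. *)
  define r where "r = map_poly (\<lambda>c. poly c z) q"
  have r: "poly r t = eval2 q t z" for t
    unfolding r_def eval2_def by (induction q) (simp_all add: map_poly_pCons)
  then have "r \<noteq> 0" using assms by force
  then show ?thesis using poly_roots_finite[of r] by (simp add: r)
qed

text \<open>At a real point the values of F are real up to a common factor, so the coordinate t of the image is
the complex number \<open>Complex (R Cx) (- R Cy)\<close> over R Cw, and the polynomial identities become identities of
complex numbers.\<close>

lemma real_moebius:
  assumes hom: "\<And>i. homogeneous d (F i)"
    and z_eq: "pull (F Cz) = [:[:0, 1:]:] * pull (F Cw)"
    and t_eq: "(pull (F Cx) - const2 \<i> * pull (F Cy)) * [:e, c:] = pull (F Cw) * [:b, a:]"
    and t: "t \<noteq> 0" "(cmod t)\<^sup>2 = 1 - z\<^sup>2"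
    and R_def: "\<And>i. R i = ev id (real_point t z) (F i)"
  shows "R Cz = z * R Cw"
    and "Complex (R Cx) (- R Cy) * (poly c (of_real z) * t + poly e (of_real z))
      = of_real (R Cw) * (poly a (of_real z) * t + poly b (of_real z))"
proof -
  define k where "k = (2 * t) ^ d"
  have k: "k \<noteq> 0" using t by (simp add: k_def)
  have R: "eval2 (pull (F i)) t (of_real z) = k * of_real (R i)" for i
    using eval2_pull_real[OF hom t(2)] by (simp add: k_def R_def)
  have "k * of_real (R Cz) = k * of_real (z * R Cw)"
    using arg_cong[OF z_eq, of "\<lambda>q. eval2 q t (of_real z)"]
    unfolding eval2_hom R by (simp add: algebra_simps)
  then show "R Cz = z * R Cw" using k by (simp only: mult_cancel_left of_real_eq_iff) simp
  have T: "Complex (R Cx) (- R Cy) = of_real (R Cx) - \<i> * of_real (R Cy)"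
    by (simp add: complex_eq_iff)
  have "k * (Complex (R Cx) (- R Cy) * (poly c (of_real z) * t + poly e (of_real z)))
      = k * (of_real (R Cw) * (poly a (of_real z) * t + poly b (of_real z)))"
    using arg_cong[OF t_eq, of "\<lambda>q. eval2 q t (of_real z)"]
    unfolding eval2_hom R T by (simp add: algebra_simps)
  then show "Complex (R Cx) (- R Cy) * (poly c (of_real z) * t + poly e (of_real z))
      = of_real (R Cw) * (poly a (of_real z) * t + poly b (of_real z))"
    using k by simp
qed

lemma selfmap_S_equation:
  assumes "rational_selfmap F" "v \<in> S_points"
  shows "(ev complex_of_real v (F Cw))\<^sup>2 = (ev complex_of_real v (F Cx))\<^sup>2
    + (ev complex_of_real v (F Cy))\<^sup>2 + (ev complex_of_real v (F Cz))\<^sup>2"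
proof (cases "\<exists>i. ev complex_of_real v (F i) \<noteq> 0")
  case True
  then have "(\<lambda>i. ev complex_of_real v (F i)) \<in> S_points"
    using assms by (auto simp: rational_selfmap_def)
  then show ?thesis by (simp add: S_points_def)
qed simp

text \<open>F maps a real point to a real point, so t |-> (a t + b)/(c t + e) preserves the circle |t|^2 = 1 - z^2
for almost every z in (-1, 1). On the circle the conjugate of t is h/t; inserting this gives a polynomial in t and z
that vanishes at the real points, and the relations are its coefficients.\<close>

lemma reality_relations:
  assumes self: "rational_selfmap F"
    and hom: "\<And>i. homogeneous d (F i)"
    and w: "pull (F Cw) \<noteq> 0"
    and z_eq: "pull (F Cz) = [:[:0, 1:]:] * pull (F Cw)"
    and t_eq: "(pull (F Cx) - const2 \<i> * pull (F Cy)) * [:e, c:] = pull (F Cw) * [:b, a:]"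
  shows "a * pbar b = hpoly * c * pbar e"
    and "hpoly * a * pbar a + b * pbar b = hpoly * (hpoly * c * pbar c + e * pbar e)"
proof -
  (* On the circle, Q is t times |a t + b|^2 - (1 - z^2) |c t + e|^2. *)
  define Q where "Q = [:b, a:] * [:hpoly * pbar a, pbar b:]
    - [:hpoly:] * ([:e, c:] * [:hpoly * pbar c, pbar e:])"
  have "pull (F Cw) * Q = 0"
  proof (rule eval2_eq_0_real_points)
    fix t :: complex and z :: real
    assume z: "-1 < z" "z < 1" and tz: "(cmod t)\<^sup>2 = 1 - z\<^sup>2"
    from z have "z\<^sup>2 < 1" by (simp add: abs_square_less_1 abs_less_iff)
    with tz have t: "t \<noteq> 0" by auto
    define R where "R = (\<lambda>i. ev id (real_point t z) (F i))"
    define T where "T = Complex (R Cx) (- R Cy)"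
    note real = real_moebius[where R = R, OF hom z_eq t_eq t tz fun_cong[OF R_def], folded T_def]
    show "eval2 (pull (F Cw) * Q) t (of_real z) = 0"
    proof (cases "R Cw = 0")
      case True
      then have "eval2 (pull (F Cw)) t (of_real z) = 0"
        using eval2_pull_real[OF hom tz] by (simp add: R_def)
      then show ?thesis by (simp add: eval2_hom)
    next
      case False
      define N D where "N = poly a (of_real z) * t + poly b (of_real z)"
        and "D = poly c (of_real z) * t + poly e (of_real z)"
      have "complex_of_real ((R Cw)\<^sup>2) = of_real ((R Cx)\<^sup>2 + (R Cy)\<^sup>2 + (R Cz)\<^sup>2)"
        using selfmap_S_equation[OF self of_real_S_points[OF real_point_S[OF tz]]]
        by (simp add: R_def of_real_ev)
      then have "(R Cw)\<^sup>2 = (R Cx)\<^sup>2 + (R Cy)\<^sup>2 + (R Cz)\<^sup>2"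
        by (simp only: of_real_eq_iff)
      moreover have "(R Cz)\<^sup>2 = z\<^sup>2 * (R Cw)\<^sup>2"
        by (simp add: real(1) power_mult_distrib)
      ultimately have "(R Cx)\<^sup>2 + (R Cy)\<^sup>2 = (1 - z\<^sup>2) * (R Cw)\<^sup>2"
        unfolding left_diff_distrib by linarith
      moreover have "(cmod T)\<^sup>2 = (R Cx)\<^sup>2 + (R Cy)\<^sup>2"
        by (simp add: T_def cmod_power2)
      ultimately have T2: "(cmod T)\<^sup>2 = (1 - z\<^sup>2) * (R Cw)\<^sup>2"
        by simp
      have "cmod T * cmod D = \<bar>R Cw\<bar> * cmod N"
        using arg_cong[OF real(2), of cmod] by (simp add: norm_mult N_def D_def)
      then have TD: "(cmod T)\<^sup>2 * (cmod D)\<^sup>2 = (R Cw)\<^sup>2 * (cmod N)\<^sup>2"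
        by (metis power_mult_distrib power2_abs)
      have "(R Cw)\<^sup>2 * ((1 - z\<^sup>2) * (cmod D)\<^sup>2) = (R Cw)\<^sup>2 * (cmod N)\<^sup>2"
        unfolding TD[symmetric] T2 by (simp only: mult_ac)
      then have "(1 - z\<^sup>2) * (cmod D)\<^sup>2 = (cmod N)\<^sup>2" using False by simp
      then have "complex_of_real ((1 - z\<^sup>2) * (cmod D)\<^sup>2) = of_real ((cmod N)\<^sup>2)"
        by (simp only:)
      then have "complex_of_real (1 - z\<^sup>2) * (D * cnj D) = N * cnj N"
        unfolding of_real_mult complex_norm_square .
      then have ND: "(1 - (complex_of_real z)\<^sup>2) * (D * cnj D) = N * cnj N"
        by simp
      have h: "1 - (complex_of_real z)\<^sup>2 = t * cnj t"
        using complex_norm_square[of t] by (simp add: tz)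
      have "eval2 [:hpoly * pbar a, pbar b:] t (of_real z) = t * cnj N"
        "eval2 [:hpoly * pbar c, pbar e:] t (of_real z) = t * cnj D"
        by (simp_all add: eval2_hom poly_hpoly N_def D_def h algebra_simps)
      moreover have "eval2 [:b, a:] t (of_real z) = N" "eval2 [:e, c:] t (of_real z) = D"
        by (simp_all only: eval2_hom N_def D_def)
      ultimately have "eval2 Q t (of_real z)
          = t * (N * cnj N - (1 - (complex_of_real z)\<^sup>2) * (D * cnj D))"
        by (simp only: Q_def eval2_hom poly_hpoly) (simp add: algebra_simps)
      then show ?thesis by (simp add: ND eval2_hom)
    qed
  qed
  then have "Q = 0" using w by simp
  then show "a * pbar b = hpoly * c * pbar e"
    "hpoly * a * pbar a + b * pbar b = hpoly * (hpoly * c * pbar c + e * pbar e)"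
    by (simp_all add: Q_def algebra_simps)
qed

lemma pbar_eq_0_iff: "pbar a = 0 \<longleftrightarrow> a = 0"
  by (simp add: map_poly_eq_0_iff)

lemma hpoly_nonzero: "hpoly \<noteq> 0"
  by (simp add: hpoly_def)

text \<open>For real z > 1 the left-hand side is nonnegative and the right-hand side is at most zero.\<close>

lemma norm_equation_trivial:
  assumes "a * pbar a = hpoly * c * pbar c"
  shows "a = 0"
proof -
  have "poly a (complex_of_real x) = 0" if "x > 1" for x
  proof -
    have "poly (a * pbar a) (complex_of_real x) = poly (hpoly * c * pbar c) (complex_of_real x)"
      by (simp only: assms)
    then have "complex_of_real ((cmod (poly a (of_real x)))\<^sup>2)
        = of_real ((1 - x\<^sup>2) * (cmod (poly c (of_real x)))\<^sup>2)"
      unfolding of_real_mult complex_norm_square by (simp add: poly_hpoly mult.assoc)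
    then have "(cmod (poly a (of_real x)))\<^sup>2 = (1 - x\<^sup>2) * (cmod (poly c (of_real x)))\<^sup>2"
      by (simp only: of_real_eq_iff)
    also have "\<dots> \<le> 0" using that by (intro mult_nonpos_nonneg) (simp_all add: power2_eq_square mult_ge1_I)
    finally show ?thesis by simp
  qed
  then have "complex_of_real ` {1<..} \<subseteq> {x. poly a x = 0}" by auto
  moreover have "infinite (complex_of_real ` {1<..})"
  proof
    assume "finite (complex_of_real ` {1<..})"
    then have "finite {(1::real)<..}" by (rule finite_imageD) (simp add: inj_on_def)
    then show False by (simp add: infinite_Ioi)
  qed
  ultimately have "infinite {x. poly a x = 0}" by (rule infinite_super)
  then show "a = 0" using poly_roots_finite by blast
qed

text \<open>The relations give a abar = e ebar, so the quotient of e and abar has norm one. A scalar \<mu> with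
\<mu> e = conj(\<mu> a) is then found as in Hilbert 90: 1 plus a norm-one element, multiplied by a abar to clear
denominators, or the constant i where that sum is zero.\<close>

lemma hilbert_90:
  assumes r1: "a * pbar b = hpoly * c * pbar e"
    and r2: "hpoly * a * pbar a + b * pbar b = hpoly * (hpoly * c * pbar c + e * pbar e)"
    and a: "a \<noteq> 0"
  obtains \<mu> where "\<mu> \<noteq> 0" "\<mu> * e = pbar (\<mu> * a)" "\<mu> * b = hpoly * pbar (\<mu> * c)"
proof -
  have r1': "pbar a * b = hpoly * pbar c * e"
    using arg_cong[OF r1, of pbar] by (simp add: pbar_mult pbar_pbar pbar_hpoly)
  have "hpoly * ((a * pbar a - e * pbar e) * (a * pbar a - hpoly * c * pbar c)) =
    (hpoly * a * pbar a + b * pbar b - hpoly * (hpoly * c * pbar c + e * pbar e)) * (a * pbar a)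
      - ((a * pbar b) * (pbar a * b) - (hpoly * c * pbar e) * (hpoly * pbar c * e))"
    by (simp add: algebra_simps)
  also have "\<dots> = 0" unfolding r1 r1' r2 by simp
  finally have "(a * pbar a - e * pbar e) * (a * pbar a - hpoly * c * pbar c) = 0"
    using hpoly_nonzero by simp
  then have ae: "a * pbar a = e * pbar e"
    using norm_equation_trivial[of a c] a by auto
  show ?thesis
  proof (cases "a + pbar e = 0")
    case True
    have e: "e = - pbar a"
      using arg_cong[OF True, of pbar] by (simp add: pbar_add pbar_pbar add_eq_0_iff)
    have "pbar a * b = pbar a * (- hpoly * pbar c)"
      using r1' by (simp add: e algebra_simps)
    moreover have "pbar a \<noteq> 0" using a by (simp add: pbar_eq_0_iff)
    ultimately have b: "b = - hpoly * pbar c" using mult_left_cancel by blast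
    have "pbar [:\<i>:] = - [:\<i>:]" by (simp add: map_poly_pCons)
    then show ?thesis
      by (intro that[of "[:\<i>:]"]) (simp_all only: pbar_mult e b, simp_all)
  next
    case False
    have \<mu>: "pbar (pbar a * (a + pbar e)) = a * (pbar a + e)"
      by (simp add: pbar_mult pbar_add pbar_pbar)
    show ?thesis
    proof (rule that[of "pbar a * (a + pbar e)"])
      show "pbar a * (a + pbar e) \<noteq> 0" using False a by (simp add: pbar_eq_0_iff)
      have "pbar a * (a + pbar e) * e = pbar a * (a * e + e * pbar e)" by (simp add: algebra_simps)
      also have "\<dots> = a * (pbar a + e) * pbar a" unfolding ae[symmetric] by (simp add: algebra_simps)
      finally show "pbar a * (a + pbar e) * e = pbar (pbar a * (a + pbar e) * a)"
        by (simp only: pbar_mult[of _ a] \<mu>)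
      have "pbar a * (a + pbar e) * b = (a + pbar e) * (pbar a * b)" by (simp add: algebra_simps)
      also have "\<dots> = hpoly * pbar c * (a * e + e * pbar e)"
        unfolding r1' by (simp add: algebra_simps)
      also have "\<dots> = hpoly * (a * (pbar a + e) * pbar c)"
        unfolding ae[symmetric] by (simp add: algebra_simps)
      finally show "pbar a * (a + pbar e) * b = hpoly * pbar (pbar a * (a + pbar e) * c)"
        by (simp only: pbar_mult[of _ c] \<mu>)
    qed
  qed
qed

definition no_common_real_root :: "complex poly \<Rightarrow> complex poly \<Rightarrow> bool" where
  "no_common_real_root a c \<longleftrightarrow> (\<forall>x. poly a (complex_of_real x) \<noteq> 0 \<or> poly c (complex_of_real x) \<noteq> 0)"

text \<open>The factor g is a product of real linear factors, so it is its own conjugate, and dividing by it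
preserves the unitary shape.\<close>

lemma cancel_common_real_roots:
  assumes "a \<noteq> 0"
  shows "\<exists>g a' c'. g \<noteq> 0 \<and> pbar g = g \<and> a = g * a' \<and> c = g * c' \<and> no_common_real_root a' c'"
  using assms
proof (induction "Polynomial.degree a" arbitrary: a c rule: less_induct)
  case less
  show ?case
  proof (cases "no_common_real_root a c")
    case True
    then show ?thesis by (intro exI[of _ 1] exI[of _ a] exI[of _ c]) simp
  next
    case False
    then obtain x where x: "poly a (complex_of_real x) = 0" "poly c (complex_of_real x) = 0"
      by (auto simp: no_common_real_root_def)
    let ?l = "[:- complex_of_real x, 1:]"
    obtain a1 c1 where ac: "a = ?l * a1" "c = ?l * c1"
      using x by (auto simp: poly_eq_0_iff_dvd elim!: dvdE)
    have a1: "a1 \<noteq> 0" using less.prems ac by auto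
    have l: "pbar ?l = ?l" by (simp add: map_poly_pCons)
    have "Polynomial.degree a1 < Polynomial.degree a"
      using a1 unfolding ac by (subst degree_mult_eq) auto
    from less.hyps[OF this a1, of c1] obtain g a' c' where g: "g \<noteq> 0" "pbar g = g"
      "a1 = g * a'" "c1 = g * c'" "no_common_real_root a' c'" by blast
    have "?l * g \<noteq> 0" unfolding mult_eq_0_iff using g(1) by simp
    moreover have "pbar (?l * g) = ?l * g" by (simp only: pbar_mult l g)
    moreover have "a = ?l * g * a'" "c = ?l * g * c'" by (simp_all only: ac g mult.assoc)
    ultimately show ?thesis using g(5) by blast
  qed
qed

lemma moebius_scale:
  assumes "k \<noteq> 0"
  shows "moebius (mat2 (k * a) (k * b) (k * c) (k * e)) = moebius (mat2 a b c e)"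
proof -
  have "Cz_embed k \<noteq> 0" using assms by (simp add: Cz_embed_conv)
  then show ?thesis
    by (simp add: moebius_def Cz_embed_hom mult.assoc flip: distrib_left)
qed

lemma polynomial_representative:
  fixes M :: "Cz_field^2^2"
  obtains k a b c e where "k \<noteq> 0"
    "M = mat2 (k * to_fract a) (k * to_fract b) (k * to_fract c) (k * to_fract e)"
proof -
  have "\<exists>p q. q \<noteq> 0 \<and> x = to_fract p / to_fract q" for x :: Cz_field
    by (cases x) (auto simp: Fract_conv_to_fract)
  then obtain p q where pq: "\<And>x :: Cz_field. q x \<noteq> 0 \<and> x = to_fract (p x) / to_fract (q x)"
    by metis
  have q0: "to_fract (q x) \<noteq> 0" for x using pq[of x] by simp
  (* The inverse of the product of the four denominators. *)
  define k where "k = inverse (to_fract (q (M$1$1) * q (M$1$2) * q (M$2$1) * q (M$2$2)))"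
  have k: "k \<noteq> 0" using q0 by (simp add: k_def)
  have e: "x = k * to_fract (p x * r)" if "q (M$1$1) * q (M$1$2) * q (M$2$1) * q (M$2$2) = q x * r" for x r
  proof -
    have "r \<noteq> 0" using that q0 by auto
    then show ?thesis
      unfolding k_def that using pq[of x] q0[of x] by (simp add: field_simps)
  qed
  have "M = mat2 (k * to_fract (p (M$1$1) * (q (M$1$2) * q (M$2$1) * q (M$2$2))))
      (k * to_fract (p (M$1$2) * (q (M$1$1) * q (M$2$1) * q (M$2$2))))
      (k * to_fract (p (M$2$1) * (q (M$1$1) * q (M$1$2) * q (M$2$2))))
      (k * to_fract (p (M$2$2) * (q (M$1$1) * q (M$1$2) * q (M$2$1))))"
    by (rule mat2_eqI; simp only: vector_2; rule e) (simp_all add: algebra_simps)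
  with k show ?thesis by (rule that)
qed

text \<open>These matrices commute with the real structure t |-> h / tbar, and by Hilbert 90 every matrix with nonzero
diagonal that commutes with it up to scalars is a multiple of one of them.\<close>

abbreviation unitary :: "complex poly \<Rightarrow> complex poly \<Rightarrow> Cz_field^2^2" where
  "unitary a c \<equiv> mat2 (to_fract a) (to_fract (hpoly * pbar c)) (to_fract c) (to_fract (pbar a))"

text \<open>The relations leave two shapes. If a = 0 then e = 0 as well, and an antidiagonal matrix has a scalar
square. Otherwise Hilbert 90 applies.\<close>

lemma H_group_normal_form:
  assumes A: "A \<in> H_group"
  obtains (involution) "A \<otimes>\<^bsub>PGL2\<^esub> A = \<one>\<^bsub>PGL2\<^esub>"
  | (unitary) F a c where "F \<in> Aut_S_pi" "psi_conj F = moebius (unitary a c)"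
      "A = proj (unitary a c)" "a \<noteq> 0" "no_common_real_root a c"
proof -
  obtain F M where FM: "F \<in> Aut_S_pi" "M \<in> A" "psi_conj F = moebius M" "A \<in> carrier PGL2"
    using A by (auto simp: H_group_def)
  obtain k a b c e where k: "k \<noteq> 0"
    and M: "M = mat2 (k * to_fract a) (k * to_fract b) (k * to_fract c) (k * to_fract e)"
    by (rule polynomial_representative)
  define N where "N = mat2 (to_fract a) (to_fract b) (to_fract c) (to_fract e)"
  have AN: "A = proj N" and psiN: "psi_conj F = moebius N"
    using PGL2_memberD(1)[OF FM(4,2)] FM(3) k by (simp_all add: M N_def proj_mat2_scale moebius_scale)
  have invN: "invertible N"
    using PGL2_memberD(2)[of A N] FM(4) AN in_proj_self by blast
  then have det: "a * e - b * c \<noteq> 0"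
    unfolding N_def invertible_mat2 by (simp flip: to_fract_mult to_fract_diff)
  have self: "rational_selfmap F" using FM(1) by (simp add: Aut_S_pi_def)
  then obtain d where hom: "\<And>i. homogeneous d (F i)"
    by (auto simp: rational_selfmap_def rational_map_def)
  have "c \<noteq> 0 \<or> e \<noteq> 0" using det by auto
  note ids = moebius_identity[OF hom psiN[unfolded N_def] this]
  note rel = reality_relations[OF self hom ids]
  show ?thesis
  proof (cases "a = 0")
    case True
    then have "hpoly * c * pbar e = 0" using rel(1) by simp
    then have "e = 0" using det True hpoly_nonzero by (auto simp: pbar_eq_0_iff)
    then have "N ** N = mat (to_fract (b * c))"
      by (simp add: N_def True mat2_mult mat_mat2 mult.commute)
    moreover have "to_fract (b * c) \<noteq> 0" using det True by (simp only: to_fract_eq_0_iff) auto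
    ultimately have "A \<otimes>\<^bsub>PGL2\<^esub> A = \<one>\<^bsub>PGL2\<^esub>"
      unfolding AN proj_mult[OF invN invN] proj_eq_one_iff by blast
    then show ?thesis by (rule involution)
  next
    case False
    obtain \<mu> where \<mu>: "\<mu> \<noteq> 0" "\<mu> * e = pbar (\<mu> * a)" "\<mu> * b = hpoly * pbar (\<mu> * c)"
      using hilbert_90[OF rel False] .
    have "\<mu> * a \<noteq> 0" using \<mu> False by simp
    from cancel_common_real_roots[OF this, of "\<mu> * c"] obtain g a' c' where g: "g \<noteq> 0" "pbar g = g"
      "\<mu> * a = g * a'" "\<mu> * c = g * c'" "no_common_real_root a' c'" by blast
    have be: "\<mu> * b = g * (hpoly * pbar c')" "\<mu> * e = g * pbar a'"
      using \<mu>(2,3) g(2) unfolding g(3,4) by (simp_all add: pbar_mult)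
    define l where "l = to_fract g / to_fract \<mu>"
    have l: "l \<noteq> 0" using g(1) \<mu>(1) by (simp add: l_def)
    have l_eq: "to_fract p = l * to_fract q" if "\<mu> * p = g * q" for p q
    proof -
      have "to_fract \<mu> * to_fract p = to_fract g * to_fract q"
        using arg_cong[OF that, of to_fract] by (simp only: to_fract_mult)
      then show ?thesis using \<mu>(1) by (simp add: l_def field_simps)
    qed
    have N: "N = mat2 (l * to_fract a') (l * to_fract (hpoly * pbar c')) (l * to_fract c')
        (l * to_fract (pbar a'))"
      unfolding N_def l_eq[OF g(3)] l_eq[OF g(4)] l_eq[OF be(1)] l_eq[OF be(2)] ..
    have "a' \<noteq> 0" using g(3) \<mu>(1) False by auto
    then show ?thesis
      using unitary[OF FM(1) _ _ _ g(5)] AN psiN unfolding N proj_mat2_scale[OF l] moebius_scale[OF l]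
      by blast
  qed
qed

section \<open>Automorphisms contract no real circle\<close>
lemma same_map_pull:
  assumes "same_map UNIV F G"
  shows "pull (F i) * pull (G j) = pull (F j) * pull (G i)"
proof (rule eval2_eqI)
  fix t z :: complex assume "t \<noteq> 0"
  then show "eval2 (pull (F i) * pull (G j)) t z = eval2 (pull (F j) * pull (G i)) t z"
    using assms eval2_param_S[of t z] by (simp add: eval2_hom eval2_pull same_map_def)
qed

lemma pull_Var: "pull (Var i) = param i"
  by (simp add: pull_def px.ev_Var)

lemma pull_S_equation:
  assumes "rational_selfmap F"
  shows "(pull (F Cw))\<^sup>2 = (pull (F Cx))\<^sup>2 + (pull (F Cy))\<^sup>2 + (pull (F Cz))\<^sup>2"
proof (rule eval2_eqI)
  fix t z :: complex assume "t \<noteq> 0"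
  then show "eval2 ((pull (F Cw))\<^sup>2) t z
      = eval2 ((pull (F Cx))\<^sup>2 + (pull (F Cy))\<^sup>2 + (pull (F Cz))\<^sup>2) t z"
    using selfmap_S_equation[OF assms eval2_param_S[of t z]] by (simp add: eval2_hom eval2_pull)
qed

text \<open>G after F is the identity, hence so is G' after F' for any other representatives. At points where F or G
vanishes the first statement is empty; but the ring of polynomials in t and z has no zero divisors, so
the identity may be transferred there and then specialised to such points as well.\<close>

lemma inverse_at_local_representatives:
  assumes F: "rational_selfmap F" and inv: "inverse_maps F G"
    and F': "rational_map UNIV F'" "same_map UNIV F' F"
    and G': "rational_map UNIV G'" "same_map UNIV G' G"
    and w: "pull (F Cw) \<noteq> 0" and nz: "pull (F' k) \<noteq> 0" and G: "rational_selfmap G"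
  defines "g' \<equiv> \<lambda>i. ev (\<lambda>r. const2 (complex_of_real r)) (\<lambda>j. pull (F' j)) (G' i)"
  shows "g' i * param j = g' j * param i"
proof -
  let ?c = "\<lambda>r. const2 (complex_of_real r)"
  define f f' where "f = (\<lambda>i. pull (F i))" and "f' = (\<lambda>i. pull (F' i))"
  have cross: "f' i * f j = f' j * f i" for i j
    using same_map_pull[OF F'(2)] by (simp add: f_def f'_def)
  have fw: "f Cw \<noteq> 0" using w by (simp add: f_def)
  have f'w: "f' Cw \<noteq> 0"
  proof
    assume "f' Cw = 0"
    then have "f' k * f Cw = 0" using cross[of k Cw] by simp
    then show False using fw nz by (simp add: f'_def)
  qed
  obtain e where e: "\<And>i. homogeneous e (G i)"
    using G by (auto simp: rational_selfmap_def rational_map_def)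
  define g gf where "g = (\<lambda>i. ev ?c f' (G i))" and "gf = (\<lambda>i. ev ?c f (G i))"
  have gf: "gf i = pull (comp_map G F i)" for i
    using ev_comp_map[OF px.structure_map_axioms, of param G F i] by (simp add: gf_def f_def pull_def)
  have GF: "rational_map UNIV (comp_map G F)" "same_map UNIV (comp_map G F) Var"
    using inv by (auto simp: inverse_maps_def)
  have gf_param: "gf i * param j = gf j * param i" for i j
    using same_map_pull[OF GF(2), of i j] by (simp add: gf pull_Var)
  (* G after F does not vanish identically on S, so it does not vanish identically on the plane either. *)
  obtain l where gfl: "gf l \<noteq> 0"
    using GF(1) pull_nonzero unfolding gf rational_map_def by blast
  have scale: "f Cw ^ e * g i = f' Cw ^ e * gf i" for i
  proof -
    have "(\<lambda>j. f Cw * f' j) = (\<lambda>j. f' Cw * f j)" using cross by (auto simp: mult.commute)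
    then show ?thesis unfolding g_def gf_def ev_homogeneous[OF e, symmetric] by simp
  qed
  have g_param: "g i * param j = g j * param i" for i j
  proof -
    have "f Cw ^ e * (g i * param j) = (f Cw ^ e * g i) * param j" by (simp add: mult.assoc)
    also have "\<dots> = f' Cw ^ e * (gf i * param j)" by (simp add: scale mult.assoc)
    also have "\<dots> = (f' Cw ^ e * gf j) * param i" unfolding gf_param[of i j] by (simp add: mult.assoc)
    also have "\<dots> = f Cw ^ e * (g j * param i)" by (simp add: mult.assoc flip: scale)
    finally show ?thesis using fw by simp
  qed
  have gl: "g l \<noteq> 0" using scale[of l] gfl f'w by auto
  have S': "(f' Cw)\<^sup>2 = (f' Cx)\<^sup>2 + (f' Cy)\<^sup>2 + (f' Cz)\<^sup>2"
  proof -
    have "(f Cw)\<^sup>2 * (f' i)\<^sup>2 = (f' Cw)\<^sup>2 * (f i)\<^sup>2" for i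
      using cross[of i Cw] by (metis power_mult_distrib mult.commute)
    then have "(f Cw)\<^sup>2 * ((f' Cx)\<^sup>2 + (f' Cy)\<^sup>2 + (f' Cz)\<^sup>2)
        = (f' Cw)\<^sup>2 * ((f Cx)\<^sup>2 + (f Cy)\<^sup>2 + (f Cz)\<^sup>2)"
      by (simp only: distrib_left)
    also have "\<dots> = (f Cw)\<^sup>2 * (f' Cw)\<^sup>2"
      using pull_S_equation[OF F] by (simp add: f_def)
    finally show ?thesis using fw by simp
  qed
  have g'g: "g' i * g j = g' j * g i" for i j
  proof -
    (* The factor f' Cw removes the points where F' vanishes and same_map for G' and G says nothing. *)
    have "f' Cw * (g' i * g j) = f' Cw * (g' j * g i)"
    proof (rule eval2_eqI)
      fix t z :: complex
      define y where "y = (\<lambda>j. eval2 (f' j) t z)"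
      have "y \<in> S_points" if "y Cw \<noteq> 0"
      proof -
        have "(y Cw)\<^sup>2 = (y Cx)\<^sup>2 + (y Cy)\<^sup>2 + (y Cz)\<^sup>2"
          using arg_cong[OF S', of "\<lambda>q. eval2 q t z"] by (simp add: eval2_hom y_def)
        then show ?thesis using that by (auto simp: S_points_def)
      qed
      then have "y Cw = 0 \<or> ev complex_of_real y (G' i) * ev complex_of_real y (G j)
          = ev complex_of_real y (G' j) * ev complex_of_real y (G i)"
        using G'(2) by (auto simp: same_map_def)
      then show "eval2 (f' Cw * (g' i * g j)) t z = eval2 (f' Cw * (g' j * g i)) t z"
        by (auto simp: eval2_hom g'_def g_def eval2_ev y_def f'_def)
    qed
    then show ?thesis using f'w by simp
  qed
  have "g l * (g' i * param j) = (g' i * g l) * param j" by (simp add: mult.commute mult.left_commute)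
  also have "\<dots> = g' l * (g i * param j)" by (simp add: g'g[of i l] mult.assoc)
  also have "\<dots> = (g' l * g j) * param i" by (simp add: g_param[of i j] mult.assoc)
  also have "\<dots> = g l * (g' j * param i)" by (simp add: g'g[of l j] mult.commute mult.left_commute)
  finally show ?thesis using gl by simp
qed

text \<open>When |a|^2 = h |c|^2 at z, the numerator a t + h cbar is the multiple a/c of the denominator, so the image
point does not depend on t.\<close>

lemma contracted_circle:
  assumes ids: "\<And>i. homogeneous d (F i)" "pull (F Cz) = [:[:0, 1:]:] * pull (F Cw)"
    "(pull (F Cx) - const2 \<i> * pull (F Cy)) * [:pbar a, c:] = pull (F Cw) * [:hpoly * pbar c, a:]"
    and t: "t \<noteq> 0" "(cmod t)\<^sup>2 = 1 - z\<^sup>2"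
    and deg: "poly a (of_real z) * cnj (poly a (of_real z))
      = (1 - (of_real z)\<^sup>2) * poly c (of_real z) * cnj (poly c (of_real z))"
    and c: "poly c (of_real z) \<noteq> 0" "poly c (of_real z) * t + cnj (poly a (of_real z)) \<noteq> 0"
  shows "ev id (real_point t z) (F i) = ev id (real_point t z) (F Cw)
    * real_point (poly a (of_real z) / poly c (of_real z)) z i"
proof -
  define a0 c0 where "a0 = poly a (complex_of_real z)" and "c0 = poly c (complex_of_real z)"
  define R where "R = (\<lambda>i. ev id (real_point t z) (F i))"
  note real = real_moebius[where R = R, OF ids t fun_cong[OF R_def], folded a0_def c0_def]
  have "(a0 / c0) * (c0 * t + cnj a0) = a0 * t + a0 * cnj a0 / c0"
    using c by (simp add: c0_def field_simps)
  also have "a0 * cnj a0 / c0 = (1 - (of_real z)\<^sup>2) * cnj c0"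
    using deg c(1) by (simp add: a0_def c0_def)
  finally have "of_real (R Cw) * (a0 * t + (1 - (of_real z)\<^sup>2) * cnj c0)
      = (of_real (R Cw) * (a0 / c0)) * (c0 * t + cnj a0)"
    by (simp only: mult.assoc)
  then have "Complex (R Cx) (- R Cy) * (c0 * t + cnj a0) = (of_real (R Cw) * (a0 / c0)) * (c0 * t + cnj a0)"
    using real(2) by (simp add: poly_hpoly a0_def c0_def)
  then have T: "Complex (R Cx) (- R Cy) = of_real (R Cw) * (a0 / c0)"
    using c(2) mult_right_cancel unfolding a0_def c0_def by blast
  have "Re (of_real r * u) = r * Re u" "Im (of_real r * u) = r * Im u" for r u
    by simp_all
  then have "R Cx = R Cw * Re (a0 / c0)" "- R Cy = R Cw * Im (a0 / c0)"
    using arg_cong[OF T, of Re] arg_cong[OF T, of Im] by (simp_all only: complex.sel)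
  then have "R i = R Cw * real_point (a0 / c0) z i"
    using real(1) by (cases i) (simp_all add: real_point_def)
  then show ?thesis by (simp add: R_def a0_def c0_def)
qed

text \<open>At a zero of the determinant in (-1, 1) the circle over z is sent to a single real point q. Representatives
F' and G' that are defined at a point of the circle and at q, respectively, compose to the identity,
so G' maps q to two different points of the circle.\<close>

lemma nonvanishing_interior:
  assumes F: "F \<in> Aut_S_pi" and psi: "psi_conj F = moebius (unitary a c)"
    and a: "a \<noteq> 0" and cop: "no_common_real_root a c"
  shows "nonvanishing_on {-1<..<1} a c"
  unfolding nonvanishing_on_def
proof (intro ballI notI)
  fix z :: real assume z: "z \<in> {-1<..<1}"
    and "poly (a * pbar a - hpoly * c * pbar c) (complex_of_real z) = 0"
  then have deg: "poly a (of_real z) * cnj (poly a (of_real z))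
      = (1 - (complex_of_real z)\<^sup>2) * poly c (of_real z) * cnj (poly c (of_real z))"
    by (simp add: poly_hpoly)
  define a0 c0 where "a0 = poly a (complex_of_real z)" and "c0 = poly c (complex_of_real z)"
  have c0: "c0 \<noteq> 0"
    using cop deg by (auto simp: no_common_real_root_def c0_def)
  have h: "0 < 1 - z\<^sup>2" using z by (simp add: abs_square_less_1 abs_less_iff)
  have "complex_of_real ((cmod a0)\<^sup>2) = complex_of_real ((1 - z\<^sup>2) * (cmod c0)\<^sup>2)"
    unfolding of_real_mult complex_norm_square using deg by (simp add: a0_def c0_def mult.assoc)
  then have "(cmod a0)\<^sup>2 = (1 - z\<^sup>2) * (cmod c0)\<^sup>2" by (simp only: of_real_eq_iff)
  then have q: "real_point (a0 / c0) z \<in> S_points"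
    using c0 by (intro real_point_S) (simp add: norm_divide power_divide)
  obtain G where self: "rational_selfmap F" "rational_selfmap G" and inv: "inverse_maps F G"
    and defd: "\<And>v. v \<in> S_points \<Longrightarrow> defined_at F v" "\<And>v. v \<in> S_points \<Longrightarrow> defined_at G v"
    using F by (auto simp: Aut_S_pi_def)
  obtain d where hom: "\<And>i. homogeneous d (F i)"
    using self(1) by (auto simp: rational_selfmap_def rational_map_def)
  have "c \<noteq> 0 \<or> pbar a \<noteq> 0" using a by (simp add: pbar_eq_0_iff)
  note ids = moebius_identity[OF hom psi this]
  define C where "C = {t. (cmod t)\<^sup>2 = 1 - z\<^sup>2}"
  have C: "infinite C" unfolding C_def by (rule infinite_circle[OF h])
  have t0: "t \<noteq> 0" if "t \<in> C" for t using that h by (auto simp: C_def)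
  (* A point of the circle where the denominator does not vanish, and below a second one. *)
  obtain s where s: "s \<in> C" "c0 * s + cnj a0 \<noteq> 0"
  proof -
    have "infinite (C - {- cnj a0 / c0})" using C by simp
    then obtain s where "s \<in> C - {- cnj a0 / c0}" by (metis ex_in_conv finite.emptyI)
    then show ?thesis using that c0 by (auto simp: field_simps add_eq_0_iff)
  qed
  obtain F' k where F': "rational_map UNIV F'" "same_map UNIV F' F" "ev id (real_point s z) (F' k) \<noteq> 0"
    using defd(1)[OF real_point_S, of s z] s(1) by (auto simp: defined_at_def C_def)
  obtain G' l where G': "rational_map UNIV G'" "same_map UNIV G' G"
    "ev id (real_point (a0 / c0) z) (G' l) \<noteq> 0"
    using defd(2)[OF q] by (auto simp: defined_at_def)
  obtain d' where hom': "\<And>i. homogeneous d' (F' i)" using F'(1) by (auto simp: rational_map_def)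
  obtain e' where homG': "\<And>i. homogeneous e' (G' i)" using G'(1) by (auto simp: rational_map_def)
  have s_nz: "eval2 (pull (F' k)) s (of_real z) \<noteq> 0"
    using eval2_pull_real[OF hom', of s z] s(1) t0[of s] F'(3) by (simp add: C_def)
  then have nz: "pull (F' k) \<noteq> 0" by (auto simp: eval2_hom)
  obtain t where t: "t \<in> C" "c0 * t + cnj a0 \<noteq> 0" "t \<noteq> s" "eval2 (pull (F' k)) t (of_real z) \<noteq> 0"
  proof -
    have "infinite (C - (insert s (insert (- cnj a0 / c0) {t. eval2 (pull (F' k)) t (of_real z) = 0})))"
      using C finite_eval2_zeros[OF s_nz] by simp
    then obtain t where "t \<in> C - (insert s (insert (- cnj a0 / c0)
        {t. eval2 (pull (F' k)) t (of_real z) = 0}))" by (metis ex_in_conv finite.emptyI)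
    then show ?thesis using that c0 by (auto simp: field_simps add_eq_0_iff)
  qed
  note w = ids(1)
  have p: "pull (F Cw) * pull (F' i) = pull (F' Cw) * pull (F i)" for i
    using same_map_pull[OF F'(2), of i Cw] by (metis mult.commute)
  have id1: "pull (F' Cz) = [:[:0, 1:]:] * pull (F' Cw)"
  proof -
    have "pull (F Cw) * pull (F' Cz) = pull (F' Cw) * pull (F Cz)" by (rule p)
    also have "\<dots> = pull (F Cw) * ([:[:0, 1:]:] * pull (F' Cw))"
      by (simp only: ids(2) mult_ac)
    finally show ?thesis using w by (simp only: mult_cancel_left)  simp
  qed
  have id2: "(pull (F' Cx) - const2 \<i> * pull (F' Cy)) * [:pbar a, c:]
      = pull (F' Cw) * [:hpoly * pbar c, a:]"
  proof -
    have "pull (F Cw) * ((pull (F' Cx) - const2 \<i> * pull (F' Cy)) * [:pbar a, c:])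
        = (pull (F Cw) * pull (F' Cx) - const2 \<i> * (pull (F Cw) * pull (F' Cy))) * [:pbar a, c:]"
      by (simp only: right_diff_distrib left_diff_distrib mult_ac)
    also have "\<dots> = pull (F' Cw) * ((pull (F Cx) - const2 \<i> * pull (F Cy)) * [:pbar a, c:])"
      unfolding p by (simp only: right_diff_distrib left_diff_distrib mult_ac)
    also have "\<dots> = pull (F Cw) * (pull (F' Cw) * [:hpoly * pbar c, a:])"
      unfolding ids(3) by (simp only: mult_ac)
    finally show ?thesis using w by (simp only: mult_cancel_left) simp
  qed
  define g where "g = (\<lambda>i. ev id (real_point (a0 / c0) z) (G' i))"
  have g: "g i = g Cw * real_point u z i"
    if u: "u \<in> C" "c0 * u + cnj a0 \<noteq> 0" "eval2 (pull (F' k)) u (of_real z) \<noteq> 0" for u i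
  proof -
    have u2: "(cmod u)\<^sup>2 = 1 - z\<^sup>2" using u(1) by (simp add: C_def)
    note u0 = t0[OF u(1)]
    define R where "R = (\<lambda>i. ev id (real_point u z) (F' i))"
    have R: "R i = R Cw * real_point (a0 / c0) z i" for i
      unfolding R_def a0_def c0_def
      by (rule contracted_circle[OF hom' id1 id2 u0 u2 deg c0[unfolded c0_def]
            u(2)[unfolded a0_def c0_def]])
    have f': "eval2 (pull (F' i)) u (of_real z) = (2 * u) ^ d' * of_real (R i)" for i
      using eval2_pull_real[OF hom' u2] by (simp add: R_def)
    have "R k \<noteq> 0" using u(3) f'[of k] by auto
    then have Rw: "R Cw \<noteq> 0" using R[of k] by auto
    define m where "m = (2 * u) ^ d' * of_real (R Cw)"
    have m: "m \<noteq> 0" using u0 Rw by (simp add: m_def)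
    have f'm: "(\<lambda>j. eval2 (pull (F' j)) u (of_real z)) = (\<lambda>j. m * of_real (real_point (a0 / c0) z j))"
      by (rule ext, subst f', subst R) (simp add: m_def)
    have "m ^ e' * of_real (g i) * (2 * u * of_real (real_point u z j))
        = m ^ e' * of_real (g j) * (2 * u * of_real (real_point u z i))" for i j
      using arg_cong[OF inverse_at_local_representatives[OF self(1) inv F'(1,2) G'(1,2) w nz self(2), of i j],
          of "\<lambda>q. eval2 q u (of_real z)"]
      by (simp add: eval2_hom eval2_ev f'm ev_homogeneous[OF homG'] eval2_param_real[OF u2]
          g_def flip: of_real_ev)
    from this[of i Cw] have "complex_of_real (g i * real_point u z Cw) = of_real (g Cw * real_point u z i)"
      using m u0 by (simp add: algebra_simps)
    then have "g i * real_point u z Cw = g Cw * real_point u z i" by (simp only: of_real_eq_iff)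
    then show ?thesis by (simp add: real_point_def)
  qed
  have "g l \<noteq> 0" using G'(3) by (simp add: g_def)
  then have gw: "g Cw \<noteq> 0" using g[OF s s_nz, of l] by auto
  have "real_point s z i = real_point t z i" for i
    using g[OF s s_nz, of i] g[OF t(1,2,4), of i] gw by simp
  from this[of Cx] this[of Cy] have "s = t" by (simp add: real_point_def complex_eq_iff)
  with t(3) show False by simp
qed

section \<open>Matrices of finite order\<close>
text \<open>The Lucas sequence U_n: if t and d are trace and determinant of a 2 by 2 matrix M, then
M^n = U_n M - d U_(n-1).\<close>

fun lucas :: "'a::comm_ring_1 \<Rightarrow> 'a \<Rightarrow> nat \<Rightarrow> 'a" where
  "lucas t d 0 = 0"
| "lucas t d (Suc 0) = 1"
| "lucas t d (Suc (Suc n)) = t * lucas t d (Suc n) - d * lucas t d n"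

lemma lucas_binet: "(x - y) * lucas (x + y) (x * y) n = x ^ n - y ^ n"
proof (induction n rule: induct_nat_012)
  case (ge2 n)
  have "(x - y) * lucas (x + y) (x * y) (Suc (Suc n))
      = (x + y) * ((x - y) * lucas (x + y) (x * y) (Suc n)) - x * y * ((x - y) * lucas (x + y) (x * y) n)"
    by (simp add: algebra_simps)
  also have "\<dots> = x ^ Suc (Suc n) - y ^ Suc (Suc n)"
    unfolding ge2 by (simp add: algebra_simps)
  finally show ?case .
qed simp_all

text \<open>The case of equal roots, about which the Binet formula says nothing.\<close>

lemma lucas_double: "lucas (x + x) (x * x) (Suc n) = of_nat (Suc n) * x ^ n"
proof (induction n rule: induct_nat_012)
  case (ge2 n)
  show ?case unfolding lucas.simps(3)[of _ _ "Suc n"] ge2 by (simp add: algebra_simps)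
qed simp_all

lemma lucas_scale: "lucas (s * t) (s * s * d) (Suc n) = s ^ n * lucas t d (Suc n)"
proof (induction n rule: induct_nat_012)
  case (ge2 n)
  show ?case unfolding lucas.simps(3)[of _ _ "Suc n"] ge2 by (simp add: algebra_simps)
qed simp_all

lemma poly_lucas: "poly (lucas t d n) z = lucas (poly t z) (poly d z) n"
  by (induction t d n rule: lucas.induct) simp_all

lemma to_fract_lucas: "to_fract (lucas t d n) = lucas (to_fract t) (to_fract d) n"
  by (induction t d n rule: lucas.induct) simp_all

text \<open>By the Binet formula the roots x and 1 - x of X^2 - X + \<kappa> are distinct with equal n-th powers, so they have the same
absolute value. Points with |x| = |1 - x| have real part 1/2, and then \<kappa> = x (1 - x) = |x|^2.\<close>

lemma lucas_one_root:
  fixes \<kappa> :: complex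
  assumes "lucas 1 \<kappa> (Suc n) = 0"
  shows "\<exists>y::real. y \<noteq> 0 \<and> \<kappa> = of_real (1/4 + y\<^sup>2)"
proof -
  (* A root of X^2 - X + kappa; the other one is 1 - x. *)
  define x where "x = (1 + csqrt (1 - 4 * \<kappa>)) / 2"
  have "(csqrt (1 - 4 * \<kappa>))\<^sup>2 = 1 - 4 * \<kappa>" by simp
  then have \<kappa>: "\<kappa> = x * (1 - x)"
    by (simp add: x_def field_simps power2_eq_square)
  have zero: "lucas (x + (1 - x)) (x * (1 - x)) (Suc n) = 0" using assms by (simp add: \<kappa>)
  have ne: "x \<noteq> 1 - x"
  proof
    assume e: "x = 1 - x"
    then have "2 * x = 1" by (simp add: algebra_simps)
    then have "x \<noteq> 0" by auto
    moreover have "lucas (x + x) (x * x) (Suc n) = 0" using zero e by metis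
    ultimately show False unfolding lucas_double by (simp del: of_nat_Suc)
  qed
  have "x ^ Suc n = (1 - x) ^ Suc n"
    using lucas_binet[of x "1 - x" "Suc n"] zero by simp
  then have "cmod x ^ Suc n = cmod (1 - x) ^ Suc n" by (metis norm_power)
  then have "cmod x = cmod (1 - x)"
    by (rule power_eq_imp_eq_base) simp_all
  then have "(cmod x)\<^sup>2 = (cmod (1 - x))\<^sup>2" by simp
  then have re: "Re x = 1/2" unfolding cmod_power2 by (simp add: power2_eq_square algebra_simps)
  then have x: "x = Complex (1/2) (Im x)" by (simp add: complex_eq_iff)
  have "Im x \<noteq> 0"
    using ne re by (auto simp: complex_eq_iff)
  moreover have "\<kappa> = of_real (1/4 + (Im x)\<^sup>2)"
    unfolding \<kappa> by (simp add: complex_eq_iff re power2_eq_square)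
  ultimately show ?thesis by blast
qed

text \<open>At every z with t(z) nonzero, homogeneity turns the equation into one for d(z)/t(z)^2 alone, which has
finitely many solutions. One of them is attained for infinitely many z, hence identically.\<close>

lemma lucas_zero_constant_ratio:
  fixes t d :: "complex poly"
  assumes zero: "lucas t d (Suc n) = 0" and t: "t \<noteq> 0"
  shows "\<exists>y::real. y \<noteq> 0 \<and> d = [:of_real (1/4 + y\<^sup>2):] * t\<^sup>2"
proof -
  define S where "S = {z. poly t z \<noteq> 0}"
  define f where "f = (\<lambda>z. poly d z / (poly t z)\<^sup>2)"
  have S: "infinite S"
  proof
    assume "finite S"
    then have "finite (S \<union> {z. poly t z = 0})" using poly_roots_finite[OF t] by simp
    moreover have "S \<union> {z. poly t z = 0} = UNIV" by (auto simp: S_def)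
    ultimately show False by (simp add: infinite_UNIV_char_0)
  qed
  have f: "lucas 1 (f z) (Suc n) = 0" if "z \<in> S" for z
  proof -
    have "lucas (poly t z * 1) (poly t z * poly t z * f z) (Suc n) = 0"
      using arg_cong[OF zero, of "\<lambda>q. poly q z"] that
      by (simp add: poly_lucas f_def S_def power2_eq_square del: lucas.simps)
    then show ?thesis using that unfolding lucas_scale by (simp add: S_def del: lucas.simps)
  qed
  have "poly (lucas 1 [:0, 1:] (Suc n)) (0::complex) = 1"
  proof -
    have "lucas 1 (0::complex) (Suc n) = 1" by (induction n) simp_all
    then show ?thesis by (simp add: poly_lucas del: lucas.simps)
  qed
  then have "lucas 1 [:0, 1 :: complex:] (Suc n) \<noteq> 0" by (metis poly_0 zero_neq_one)
  then have "finite {x :: complex. poly (lucas 1 [:0, 1:] (Suc n)) x = 0}"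
    by (rule poly_roots_finite)
  moreover have "f ` S \<subseteq> {x. poly (lucas 1 [:0, 1:] (Suc n)) x = 0}"
    using f by (auto simp: poly_lucas simp del: lucas.simps)
  ultimately have "finite (f ` S)" by (rule rev_finite_subset)
  then obtain z0 where z0: "z0 \<in> S" "infinite {z \<in> S. f z = f z0}"
    using pigeonhole_infinite[OF S] by blast
  obtain y :: real where y: "y \<noteq> 0" "f z0 = of_real (1/4 + y\<^sup>2)"
    using lucas_one_root[OF f[OF z0(1)]] by blast
  have "{z \<in> S. f z = f z0} \<subseteq> {z. poly (d - [:f z0:] * t\<^sup>2) z = 0}"
    by (auto simp: S_def f_def field_simps)
  then have "infinite {z. poly (d - [:f z0:] * t\<^sup>2) z = 0}" using z0(2) infinite_super by blast
  then have "d - [:f z0:] * t\<^sup>2 = 0" using poly_roots_finite by blast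
  then show ?thesis using y by auto
qed

lemma proj_power:
  fixes a b c e :: "'a::field"
  assumes inv: "invertible (mat2 a b c e)"
  defines "t \<equiv> a + e" and "d \<equiv> a * e - b * c"
  shows "proj (mat2 a b c e) [^]\<^bsub>PGL2\<^esub> Suc n =
    proj (mat2 (lucas t d (Suc n) * a - d * lucas t d n) (lucas t d (Suc n) * b)
      (lucas t d (Suc n) * c) (lucas t d (Suc n) * e - d * lucas t d n))"
proof -
  interpret PGL: group "PGL2 :: ('a^2^2) set monoid" by (rule group_PGL2)
  have A: "proj (mat2 a b c e) \<in> carrier PGL2" by (rule proj_in_PGL2[OF inv])
  show ?thesis
  proof (induction n)
    case 0
    then show ?case using A by simp
  next
    case (Suc n)
    define N where "N = mat2 (lucas t d (Suc n) * a - d * lucas t d n) (lucas t d (Suc n) * b)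
      (lucas t d (Suc n) * c) (lucas t d (Suc n) * e - d * lucas t d n)"
    have "proj N \<in> carrier PGL2" unfolding N_def Suc[symmetric] using A by (rule PGL.nat_pow_closed)
    then have "invertible N" using PGL2_memberD(2) in_proj_self by blast
    moreover have "proj (mat2 a b c e) [^]\<^bsub>PGL2\<^esub> Suc (Suc n) = proj N \<otimes>\<^bsub>PGL2\<^esub> proj (mat2 a b c e)"
      using Suc by (simp only: PGL.nat_pow_Suc N_def)
    ultimately have "proj (mat2 a b c e) [^]\<^bsub>PGL2\<^esub> Suc (Suc n) = proj (N ** mat2 a b c e)"
      by (simp only: proj_mult inv)
    also have "N ** mat2 a b c e =
        mat2 (lucas t d (Suc (Suc n)) * a - d * lucas t d (Suc n)) (lucas t d (Suc (Suc n)) * b)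
          (lucas t d (Suc (Suc n)) * c) (lucas t d (Suc (Suc n)) * e - d * lucas t d (Suc n))"
      unfolding N_def mat2_mult lucas.simps(3) by (simp add: t_def d_def algebra_simps)
    finally show ?case .
  qed
qed

text \<open>The off-diagonal entries of the power, and the difference of its diagonal entries, are Lucas multiples of those of
the matrix. So if the Lucas term were not zero, the matrix itself would be scalar.\<close>

lemma unitary_finite_order:
  assumes A: "A = proj (unitary a c)" "A \<in> carrier PGL2"
    and fin: "A [^]\<^bsub>PGL2\<^esub> Suc n = \<one>\<^bsub>PGL2\<^esub>" and no_inv: "A \<otimes>\<^bsub>PGL2\<^esub> A \<noteq> \<one>\<^bsub>PGL2\<^esub>"
  shows "\<exists>y::real. y \<noteq> 0 \<and>
    a * pbar a - hpoly * c * pbar c = [:of_real (1/4 + y\<^sup>2):] * (a + pbar a)\<^sup>2"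
proof -
  interpret PGL: group "PGL2 :: (Cz_field^2^2) set monoid" by (rule group_PGL2)
  define t d where "t = a + pbar a" and "d = a * pbar a - hpoly * c * pbar c"
  have inv: "invertible (unitary a c)" using PGL2_memberD(2)[OF A(2)] A(1) in_proj_self by blast
  have td: "to_fract a + to_fract (pbar a) = to_fract t"
    "to_fract a * to_fract (pbar a) - to_fract (hpoly * pbar c) * to_fract c = to_fract d"
    by (simp_all add: t_def d_def algebra_simps)
  have d: "to_fract d \<noteq> 0" using inv unfolding invertible_mat2 td .
  note power = proj_power[OF inv, folded A(1), unfolded td]
  have t: "t \<noteq> 0"
  proof
    assume "t = 0"
    then have "A [^]\<^bsub>PGL2\<^esub> Suc (Suc 0) = proj (mat (- to_fract d))"
      unfolding power by (simp add: mat_mat2)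
    then have "A [^]\<^bsub>PGL2\<^esub> Suc (Suc 0) = \<one>\<^bsub>PGL2\<^esub>"
      using d proj_eq_one_iff[of "mat (- to_fract d)"] by (metis neg_equal_0_iff_equal)
    then show False using no_inv A(2) by simp
  qed
  have "lucas t d (Suc n) = 0"
  proof (rule ccontr)
    assume u: "lucas t d (Suc n) \<noteq> 0"
    then have u': "lucas (to_fract t) (to_fract d) (Suc n) \<noteq> 0"
      by (simp only: to_fract_eq_0_iff flip: to_fract_lucas) simp
    define U D where "U = lucas (to_fract t) (to_fract d) (Suc n)"
      and "D = to_fract d * lucas (to_fract t) (to_fract d) n"
    obtain k where "mat2 (U * to_fract a - D) (U * to_fract (hpoly * pbar c)) (U * to_fract c)
        (U * to_fract (pbar a) - D) = mat2 k 0 0 k"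
      using fin unfolding power proj_eq_one_iff mat_mat2 U_def D_def by blast
    then have "U * to_fract c = 0" and eq: "U * to_fract a - D = k" "U * to_fract (pbar a) - D = k"
      by (simp_all only: vec_eq_iff forall_2 vector_2)
    moreover have "U * to_fract a = U * to_fract (pbar a)"
      using eq by (simp add: diff_eq_eq)
    ultimately have "c = 0" "a = pbar a"
      using u' by (simp_all add: U_def del: lucas.simps)
    then have m: "unitary a c = mat (to_fract a)" by (simp add: mat_mat2)
    have "a \<noteq> 0" using d \<open>c = 0\<close> by (auto simp: d_def)
    then have "A = \<one>\<^bsub>PGL2\<^esub>" unfolding A(1) proj_eq_one_iff m by (intro exI[of _ "to_fract a"]) simp
    then show False using no_inv by simp
  qed
  from lucas_zero_constant_ratio[OF this t] show ?thesis by (simp add: t_def d_def)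
qed

section \<open>Diagonalisation over the real surface\<close>

text \<open>Here \<sigma> = \<tau>/2 is the real part of a; with \<eta> = 2y\<sigma> = y\<tau> and \<alpha> the imaginary part of a, the eigenvalues of
the unitary matrix are \<sigma> + i\<eta> and \<sigma> - i\<eta>, and (i(\<eta> + \<alpha>), c) is an eigenvector for the first one. The
determinant of the matrix of eigenvectors is (\<eta> + \<alpha>)^2 - (\<alpha>^2 - \<eta>^2) = 2\<eta>(\<eta> + \<alpha>).\<close>

lemma diagonalising_matrix:
  fixes a c :: "complex poly" and y :: real
  defines "\<sigma> \<equiv> [:1/2:] * (a + pbar a)"
  defines "p \<equiv> [:\<i>:] * ([:2 * of_real y:] * \<sigma> + [:- \<i>/2:] * (a - pbar a))"
  assumes det: "a * pbar a - hpoly * c * pbar c = [:of_real (1/4 + y\<^sup>2):] * (a + pbar a)\<^sup>2"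
  shows "unitary a c ** unitary p c = unitary p c **
      mat2 (to_fract ([:1 + 2 * \<i> * of_real y:] * \<sigma>)) 0 0 (to_fract ([:1 - 2 * \<i> * of_real y:] * \<sigma>))"
    and "poly (p * pbar p - hpoly * c * pbar c) (of_real x) =
      of_real (2 * (2 * y * Re (poly a (of_real x))) *
        (2 * y * Re (poly a (of_real x)) + Im (poly a (of_real x))))"
    and "hpoly * c * pbar c = ([:- \<i>/2:] * (a - pbar a))\<^sup>2 - ([:2 * of_real y:] * \<sigma>)\<^sup>2"
proof -
  define I :: "complex poly" where "I = [:\<i>:]"
  define \<alpha> \<eta> where "\<alpha> = [:- \<i>/2:] * (a - pbar a)" and "\<eta> = [:2 * of_real y:] * \<sigma>"
  have II: "I * I = - 1" by (simp add: I_def one_pCons)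
  have II': "I * (I * q) = - q" for q using II by (simp flip: mult.assoc)
  have I\<alpha>: "I * \<alpha> = [:1/2:] * (a - pbar a)" by (simp add: I_def \<alpha>_def)
  have a: "a = \<sigma> + I * \<alpha>" and a': "pbar a = \<sigma> - I * \<alpha>"
    unfolding I\<alpha> \<sigma>_def by (rule poly_eqI, simp add: field_simps)+
  have \<eta>\<eta>: "[:of_real (1/4 + y\<^sup>2):] * (a + pbar a)\<^sup>2 = \<sigma> * \<sigma> + \<eta> * \<eta>"
  proof -
    have "[:of_real (1/4 + y\<^sup>2):] = [:1/2:] * [:1/2:] + ([:2 * of_real y:] * [:1/2:]) * ([:2 * complex_of_real y:] * [:1/2:])"
      by (simp add: power2_eq_square)
    moreover have "(H * H + (Y * H) * (Y * H)) * s\<^sup>2 = (H * s) * (H * s) + (Y * (H * s)) * (Y * (H * s))"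
      for H Y s :: "complex poly" by (simp add: power2_eq_square algebra_simps)
    ultimately show ?thesis unfolding \<eta>_def \<sigma>_def by (simp only:)
  qed
  have hcc: "hpoly * c * pbar c = \<alpha> * \<alpha> - \<eta> * \<eta>"
  proof -
    have "a * pbar a = (\<sigma> + I * \<alpha>) * (\<sigma> - I * \<alpha>)"
      by (simp only: a' flip: a)
    also have "\<dots> = \<sigma> * \<sigma> + \<alpha> * \<alpha>"
      by (simp add: algebra_simps II')
    finally have "a * pbar a = \<sigma> * \<sigma> + \<alpha> * \<alpha>" .
    then show ?thesis using det unfolding \<eta>\<eta> by (simp add: algebra_simps)
  qed
  then show "hpoly * c * pbar c = ([:- \<i>/2:] * (a - pbar a))\<^sup>2 - ([:2 * of_real y:] * \<sigma>)\<^sup>2"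
    by (simp add: \<alpha>_def \<eta>_def power2_eq_square)
  have p: "p = I * (\<eta> + \<alpha>)" by (simp add: p_def I_def \<eta>_def \<alpha>_def)
  have \<sigma>': "pbar \<sigma> = \<sigma>"
    by (simp add: \<sigma>_def pbar_mult pbar_add pbar_pbar map_poly_pCons add.commute del: mult_pCons_left)
  have \<alpha>': "pbar \<alpha> = \<alpha>"
  proof -
    have "pbar \<alpha> = [:\<i>/2:] * (pbar a + pbar (- a) - pbar (- a) - a)"
      unfolding \<alpha>_def by (simp only: pbar_mult diff_conv_add_uminus pbar_add pbar_uminus pbar_pbar)
        (simp add: map_poly_pCons)
    also have "\<dots> = \<alpha>" unfolding \<alpha>_def by (simp add: algebra_simps smult_diff_right)
    finally show ?thesis .
  qed
  have \<eta>': "pbar \<eta> = \<eta>"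
    unfolding \<eta>_def pbar_mult \<sigma>' by (simp add: map_poly_pCons)
  have I': "pbar I = - I" by (simp add: I_def map_poly_pCons)
  have p': "pbar p = - (I * (\<eta> + \<alpha>))" unfolding p pbar_mult pbar_add I' \<eta>' \<alpha>' by simp
  have l: "[:1 + 2 * \<i> * of_real y:] * \<sigma> = \<sigma> + I * \<eta>" "[:1 - 2 * \<i> * of_real y:] * \<sigma> = \<sigma> - I * \<eta>"
  proof -
    have "[:1 + 2 * \<i> * of_real y:] = 1 + I * [:2 * of_real y:]"
      "[:1 - 2 * \<i> * of_real y:] = 1 - I * [:2 * of_real y:]"
      by (simp_all add: I_def one_pCons)
    then show "[:1 + 2 * \<i> * of_real y:] * \<sigma> = \<sigma> + I * \<eta>" "[:1 - 2 * \<i> * of_real y:] * \<sigma> = \<sigma> - I * \<eta>"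
      unfolding \<eta>_def by (simp_all only: distrib_right left_diff_distrib mult_1_left mult.assoc)
  qed
  have e11: "a * p + hpoly * pbar c * c = p * (\<sigma> + I * \<eta>)"
  proof -
    have "a * p + hpoly * pbar c * c = a * p + (\<alpha> * \<alpha> - \<eta> * \<eta>)"
      by (simp add: mult.assoc mult.commute[of c] flip: hcc)
    then show ?thesis unfolding p a by (simp add: algebra_simps II')
  qed
  have e22: "c * (hpoly * pbar c) + pbar a * pbar p = pbar p * (\<sigma> - I * \<eta>)"
  proof -
    have "c * (hpoly * pbar c) + pbar a * pbar p = (\<alpha> * \<alpha> - \<eta> * \<eta>) + pbar a * pbar p"
      by (simp add: mult_ac flip: hcc)
    then show ?thesis unfolding p' a' by (simp add: algebra_simps II')
  qed
  have e12: "a * (hpoly * pbar c) + hpoly * pbar c * pbar p = hpoly * pbar c * (\<sigma> - I * \<eta>)"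
    unfolding p' a by (simp add: algebra_simps)
  have e21: "c * p + pbar a * c = c * (\<sigma> + I * \<eta>)"
    unfolding p a' by (simp add: algebra_simps)
  have push: "to_fract p1 * to_fract q1 + to_fract p2 * to_fract q2 = to_fract (p1 * q1 + p2 * q2)"
    for p1 q1 p2 q2 :: "complex poly" by simp
  show "unitary a c ** unitary p c = unitary p c **
      mat2 (to_fract ([:1 + 2 * \<i> * of_real y:] * \<sigma>)) 0 0 (to_fract ([:1 - 2 * \<i> * of_real y:] * \<sigma>))"
    unfolding l mat2_mult push e11 e12 e21 e22 by simp
  have "p * pbar p = (\<eta> + \<alpha>) * (\<eta> + \<alpha>)"
    unfolding p' unfolding p by (simp add: algebra_simps II')
  then have "p * pbar p - hpoly * c * pbar c = (\<eta> + \<eta>) * (\<eta> + \<alpha>)"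
    unfolding hcc by (simp add: algebra_simps)
  moreover have "poly \<sigma> (of_real x) = of_real (Re (poly a (of_real x)))"
    by (simp add: \<sigma>_def complex_add_cnj)
  moreover have "poly \<alpha> (of_real x) = of_real (Im (poly a (of_real x)))"
    by (simp add: \<alpha>_def complex_eq_iff)
  ultimately show "poly (p * pbar p - hpoly * c * pbar c) (of_real x) =
      of_real (2 * (2 * y * Re (poly a (of_real x))) *
        (2 * y * Re (poly a (of_real x)) + Im (poly a (of_real x))))"
    by (simp add: \<eta>_def algebra_simps)
qed

lemma R_rot_conv: "R_rot \<theta> = proj (mat2 1 0 0 (Cz_const (cis \<theta>)))"
  by (simp add: R_rot_def pgl_class_def cis_conv_exp)

lemma R_rot_in_H: "R_rot \<theta> \<in> H_group"
proof -
  (* Half the angle: diag(1, exp(i theta)) becomes unitary after multiplication by w. *)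
  define w where "w = cis (- \<theta> / 2)"
  have w: "w * cnj w = 1" "cis \<theta> * w = cnj w" by (simp_all add: w_def cis_mult cis_cnj)
  have "nonvanishing_on {-1..1} [:w:] 0"
    using w by (simp add: nonvanishing_on_def)
  then have "proj (unitary [:w:] 0) \<in> H_group" by (rule in_H_groupI)
  moreover have "unitary [:w:] 0 = mat2 (to_fract [:w:] * 1) (to_fract [:w:] * 0) (to_fract [:w:] * 0)
      (to_fract [:w:] * Cz_const (cis \<theta>))"
    by (simp add: map_poly_pCons Cz_const_conv w(2) flip: to_fract_mult)
  moreover have "w \<noteq> 0" by (simp add: w_def)
  ultimately show ?thesis
    by (simp only: R_rot_conv proj_mat2_scale to_fract_eq_0_iff pCons_eq_0_iff simp_thms)
qed

text \<open>At a zero of the trace in z = 1 or z = -1, where h vanishes, the determinant equation gives a(z) = 0. Then the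
trace squared and a abar vanish to second order, so does h c cbar, and as h has simple zeros c vanishes too.\<close>

lemma trace_nonzero_at_poles:
  assumes det: "a * pbar a - hpoly * c * pbar c = [:k:] * (a + pbar a)\<^sup>2"
    and cop: "no_common_real_root a c" and x: "x = 1 \<or> x = - 1"
  shows "poly (a + pbar a) (complex_of_real x) \<noteq> 0"
proof
  assume t0: "poly (a + pbar a) (complex_of_real x) = 0"
  let ?l = "[:- complex_of_real x, 1:]"
  have h0: "poly hpoly (complex_of_real x) = 0" using x by (auto simp: poly_hpoly)
  have "poly (a * pbar a) (complex_of_real x) = 0"
    using arg_cong[OF det, of "\<lambda>q. poly q (complex_of_real x)"] t0 h0 by simp
  then have a0: "poly a (complex_of_real x) = 0" by simp
  have "?l dvd a + pbar a" "?l dvd a" "?l dvd pbar a"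
    using t0 a0 by (simp_all add: poly_eq_0_iff_dvd[symmetric])
  then have "?l * ?l dvd (a + pbar a)\<^sup>2" "?l * ?l dvd a * pbar a"
    unfolding power2_eq_square by (simp_all only: mult_dvd_mono)
  then have "?l * ?l dvd a * pbar a - [:k:] * (a + pbar a)\<^sup>2"
    by (meson dvd_diff dvd_mult)
  also have "a * pbar a - [:k:] * (a + pbar a)\<^sup>2 = hpoly * c * pbar c"
    unfolding det[symmetric] by simp
  also have "hpoly = ?l * [:- complex_of_real x, - 1:]"
    using x by (auto simp: hpoly_def)
  finally have "?l * ?l dvd ?l * ([:- complex_of_real x, - 1:] * c * pbar c)"
    by (simp only: mult.assoc)
  moreover have "?l \<noteq> 0" by simp
  ultimately have "?l dvd [:- complex_of_real x, - 1:] * c * pbar c"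
    by (simp only: dvd_mult_cancel_left) simp
  then have "poly ([:- complex_of_real x, - 1:] * c * pbar c) (complex_of_real x) = 0"
    by (simp only: poly_eq_0_iff_dvd)
  then have "poly c (complex_of_real x) = 0" using x by auto
  with a0 cop show False by (auto simp: no_common_real_root_def)
qed

lemma constant_sign:
  fixes f :: "real \<Rightarrow> real"
  assumes "continuous_on {-1..1} f" "\<And>x. x \<in> {-1..1} \<Longrightarrow> f x \<noteq> 0"
  shows "(\<forall>x\<in>{-1..1}. f x > 0) \<or> (\<forall>x\<in>{-1..1}. f x < 0)"
proof (rule ccontr)
  assume "\<not> ?thesis"
  then obtain u v where u: "u \<in> {-1..1}" "f u < 0" and v: "v \<in> {-1..1}" "f v > 0"
    using assms(2) by (metis linorder_neqE_linordered_idom)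
  have "connected (f ` {-1..1})" using assms(1) by (intro connected_continuous_image) simp_all
  then have "0 \<in> f ` {-1..1}"
    using u v connectedD_interval[of "f ` {-1..1}" "f u" "f v" 0] by auto
  then show False using assms(2) by auto
qed

text \<open>The sign of y is free. It is chosen such that y\<tau>\<alpha> is positive on [-1, 1], which makes the determinant
2\<eta>(\<eta> + \<alpha>) of the matrix of eigenvectors positive.\<close>

lemma diagonalising_matrix_nonvanishing:
  assumes det: "a * pbar a - hpoly * c * pbar c = [:of_real (1/4 + y\<^sup>2):] * (a + pbar a)\<^sup>2"
    and y: "y \<noteq> 0" and nv: "nonvanishing_on {-1<..<1} a c" and cop: "no_common_real_root a c"
  obtains y' p where "y'\<^sup>2 = y\<^sup>2" "nonvanishing_on {-1..1} p c"
    "p = [:\<i>:] * ([:2 * of_real y':] * ([:1/2:] * (a + pbar a)) + [:- \<i>/2:] * (a - pbar a))"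
proof -
  define s \<alpha> where "s = (\<lambda>x::real. Re (poly a (of_real x)))" and "\<alpha> = (\<lambda>x::real. Im (poly a (of_real x)))"
  have trace: "poly (a + pbar a) (complex_of_real x) = of_real (2 * s x)" for x
    by (simp add: s_def complex_add_cnj)
  have s: "s x \<noteq> 0" if x: "x \<in> {-1..1}" for x
  proof (cases "x = 1 \<or> x = -1")
    case True
    then show ?thesis using trace_nonzero_at_poles[OF det cop True] unfolding trace by simp
  next
    case False
    then have "x \<in> {-1<..<1}" using x by auto
    then have "poly ([:of_real (1/4 + y\<^sup>2):] * (a + pbar a)\<^sup>2) (complex_of_real x) \<noteq> 0"
      using nv unfolding nonvanishing_on_def det by blast
    then show ?thesis by (auto simp: trace simp del: poly_add)
  qed
  (* The difference is h |c|^2, which is nonnegative on [-1, 1]. *)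
  have \<alpha>: "(\<alpha> x)\<^sup>2 \<ge> (2 * y * s x)\<^sup>2" if x: "x \<in> {-1..1}" for x
  proof -
    have "poly ([:- \<i>/2:] * (a - pbar a)) (complex_of_real x) = of_real (\<alpha> x)"
      "poly ([:1/2:] * (a + pbar a)) (complex_of_real x) = of_real (s x)"
      by (simp_all add: complex_eq_iff s_def \<alpha>_def)
    then have "(1 - (complex_of_real x)\<^sup>2) * (poly c (of_real x) * cnj (poly c (of_real x)))
        = (of_real (\<alpha> x))\<^sup>2 - (2 * of_real y * of_real (s x))\<^sup>2"
      using arg_cong[OF diagonalising_matrix(3)[OF det], of "\<lambda>q. poly q (complex_of_real x)"]
      by (simp only: poly_mult poly_diff poly_power poly_hpoly) (simp add: mult.assoc)
    then have "complex_of_real ((1 - x\<^sup>2) * (cmod (poly c (of_real x)))\<^sup>2)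
        = of_real ((\<alpha> x)\<^sup>2 - (2 * y * s x)\<^sup>2)"
      unfolding of_real_mult complex_norm_square by simp
    then have "(1 - x\<^sup>2) * (cmod (poly c (of_real x)))\<^sup>2 = (\<alpha> x)\<^sup>2 - (2 * y * s x)\<^sup>2"
      by (simp only: of_real_eq_iff)
    moreover have "x\<^sup>2 \<le> 1" using x by (simp add: abs_square_le_1 abs_le_iff)
    then have "0 \<le> (1 - x\<^sup>2) * (cmod (poly c (of_real x)))\<^sup>2" by simp
    ultimately show ?thesis by simp
  qed
  have \<alpha>0: "\<alpha> x \<noteq> 0" if "x \<in> {-1..1}" for x
  proof
    assume "\<alpha> x = 0"
    then have "(2 * y * s x)\<^sup>2 \<le> 0" using \<alpha>[OF that] by simp
    then show False using s[OF that] y by simp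
  qed
  have "continuous_on {-1..1} (\<lambda>x. y * s x * \<alpha> x)"
    unfolding s_def \<alpha>_def by (intro continuous_intros)
  from constant_sign[OF this] have "(\<forall>x\<in>{-1..1}. y * s x * \<alpha> x > 0) \<or> (\<forall>x\<in>{-1..1}. y * s x * \<alpha> x < 0)"
    using s \<alpha>0 y by simp
  (* Replacing y by its negative changes the sign of the product. *)
  then obtain y' where y': "y' = y \<or> y' = - y" "\<forall>x\<in>{-1..1}. y' * s x * \<alpha> x > 0"
    by (metis minus_mult_left neg_0_less_iff_less)
  then have sq: "y'\<^sup>2 = y\<^sup>2" by auto
  have det': "a * pbar a - hpoly * c * pbar c = [:of_real (1/4 + y'\<^sup>2):] * (a + pbar a)\<^sup>2"
    using det by (simp only: sq)
  define p where "p = [:\<i>:] * ([:2 * of_real y':] * ([:1/2:] * (a + pbar a)) + [:- \<i>/2:] * (a - pbar a))"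
  have "nonvanishing_on {-1..1} p c"
    unfolding nonvanishing_on_def
  proof
    fix x :: real assume x: "x \<in> {-1..1}"
    have "2 * (2 * y' * s x) * (2 * y' * s x + \<alpha> x) = 8 * (y' * s x)\<^sup>2 + 4 * (y' * s x * \<alpha> x)"
      by (simp add: power2_eq_square algebra_simps)
    also have "\<dots> > 0" using y'(2) x by (intro add_nonneg_pos) simp_all
    finally show "poly (p * pbar p - hpoly * c * pbar c) (complex_of_real x) \<noteq> 0"
      unfolding p_def diagonalising_matrix(2)[OF det'] s_def \<alpha>_def by (simp only: of_real_eq_0_iff)
  qed
  then show ?thesis using that sq p_def by blast
qed

lemma unitary_mult_adjugate:
  assumes "nonvanishing_on {-1..1} p c"
  obtains k where "k \<noteq> 0" "unitary (pbar p) (- c) ** unitary p c = mat k"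
    "unitary p c ** unitary (pbar p) (- c) = mat k"
    "invertible (unitary p c)" "invertible (unitary (pbar p) (- c))"
proof -
  have "poly (p * pbar p - hpoly * c * pbar c) (complex_of_real 0) \<noteq> 0"
    using assms by (simp add: nonvanishing_on_def del: of_real_0)
  then have "p * pbar p - hpoly * c * pbar c \<noteq> 0" by force
  then have k: "to_fract (p * pbar p - hpoly * c * pbar c) \<noteq> 0"
    by (simp only: to_fract_eq_0_iff not_False_eq_True)
  have e: "to_fract p * to_fract (pbar p) - to_fract (hpoly * pbar c) * to_fract c
      = to_fract (p * pbar p - hpoly * c * pbar c)"
    by (simp add: algebra_simps)
  show ?thesis
  proof (rule that[OF k])
    show "invertible (unitary p c)" "invertible (unitary (pbar p) (- c))"
      using k unfolding invertible_mat2 e[symmetric] by (simp_all add: pbar_uminus pbar_pbar mult_ac)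
    show "unitary (pbar p) (- c) ** unitary p c = mat (to_fract (p * pbar p - hpoly * c * pbar c))"
      "unitary p c ** unitary (pbar p) (- c) = mat (to_fract (p * pbar p - hpoly * c * pbar c))"
      unfolding mat_mat2 mat2_mult e[symmetric]
      by (simp_all add: pbar_uminus pbar_pbar mult_ac)
  qed
qed

text \<open>The conjugating element is given by the adjugate of the matrix of eigenvectors. The eigenvalues
are complex conjugate multiples of \<sigma>, so their quotient is a constant of absolute value one.\<close>

lemma conjugate_to_rotation:
  assumes A: "A = proj (unitary a c)" and y: "y \<noteq> 0"
    and det: "a * pbar a - hpoly * c * pbar c = [:of_real (1/4 + y\<^sup>2):] * (a + pbar a)\<^sup>2"
    and nv: "nonvanishing_on {-1<..<1} a c" and cop: "no_common_real_root a c"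
  shows "\<exists>\<theta>. \<exists>B\<in>H_group. B \<otimes>\<^bsub>PGL2\<^esub> A \<otimes>\<^bsub>PGL2\<^esub> inv\<^bsub>PGL2\<^esub> B = R_rot \<theta>"
proof -
  obtain y' p where y': "y'\<^sup>2 = y\<^sup>2" and p: "nonvanishing_on {-1..1} p c"
    "p = [:\<i>:] * ([:2 * of_real y':] * ([:1/2:] * (a + pbar a)) + [:- \<i>/2:] * (a - pbar a))"
    using diagonalising_matrix_nonvanishing[OF det y nv cop] .
  have det': "a * pbar a - hpoly * c * pbar c = [:of_real (1/4 + y'\<^sup>2):] * (a + pbar a)\<^sup>2"
    using det by (simp only: y')
  define \<sigma> where "\<sigma> = [:1/2:] * (a + pbar a)"
  define l1 l2 where "l1 = 1 + 2 * \<i> * of_real y'" and "l2 = 1 - 2 * \<i> * of_real y'"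
  define D where "D = mat2 (to_fract ([:l1:] * \<sigma>)) 0 0 (to_fract ([:l2:] * \<sigma>))"
  have AP: "unitary a c ** unitary p c = unitary p c ** D"
    using diagonalising_matrix(1)[OF det'] unfolding p(2) D_def l1_def l2_def \<sigma>_def .
  obtain k where k: "k \<noteq> 0" "unitary (pbar p) (- c) ** unitary p c = mat k"
    "unitary p c ** unitary (pbar p) (- c) = mat k"
    "invertible (unitary p c)" "invertible (unitary (pbar p) (- c))"
    using unitary_mult_adjugate[OF p(1)] .
  have "poly (a * pbar a - hpoly * c * pbar c) (complex_of_real 0) \<noteq> 0"
    using nv by (simp add: nonvanishing_on_def del: of_real_0)
  then have det0: "a * pbar a - hpoly * c * pbar c \<noteq> 0" by force
  then have "to_fract (a * pbar a - hpoly * c * pbar c) \<noteq> 0"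
    by (simp only: to_fract_eq_0_iff not_False_eq_True)
  then have invA: "invertible (unitary a c)"
    unfolding invertible_mat2 by (simp add: mult_ac)
  have \<sigma>: "\<sigma> \<noteq> 0" using det0 unfolding det \<sigma>_def by auto
  define B where "B = proj (unitary (pbar p) (- c))"
  have "B \<in> H_group"
    unfolding B_def using p(1) by (intro in_H_groupI) (simp add: nonvanishing_on_inverse)
  moreover have "B \<otimes>\<^bsub>PGL2\<^esub> A \<otimes>\<^bsub>PGL2\<^esub> inv\<^bsub>PGL2\<^esub> B = R_rot (Arg (l2 / l1))"
  proof -
    have "inv\<^bsub>PGL2\<^esub> B = proj (unitary p c)"
      unfolding B_def by (rule inv_proj[OF k(5,4,3,1)])
    then have "B \<otimes>\<^bsub>PGL2\<^esub> A \<otimes>\<^bsub>PGL2\<^esub> inv\<^bsub>PGL2\<^esub> B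
        = proj (unitary (pbar p) (- c) ** unitary a c ** unitary p c)"
      unfolding B_def A by (simp only: proj_mult k(4,5) invA invertible_mult)
    also have "unitary (pbar p) (- c) ** unitary a c ** unitary p c = mat k ** D"
      by (simp only: AP k(2) matrix_mul_assoc flip: matrix_mul_assoc[of _ "unitary a c"])
    also have "proj (mat k ** D) = proj D" by (rule proj_scale[OF k(1)])
    also have "proj D = proj (mat2 1 0 0 (Cz_const (l2 / l1)))"
    proof -
      have l1: "l1 \<noteq> 0" by (simp add: l1_def complex_eq_iff)
      have "[:l2:] * \<sigma> = [:l1:] * \<sigma> * [:l2 / l1:]" using l1 by simp
      then have "D = mat2 (to_fract ([:l1:] * \<sigma>) * 1) (to_fract ([:l1:] * \<sigma>) * 0)
          (to_fract ([:l1:] * \<sigma>) * 0) (to_fract ([:l1:] * \<sigma>) * Cz_const (l2 / l1))"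
        unfolding D_def Cz_const_conv to_fract_mult[symmetric] by (simp only: mult_1_right mult_zero_right)
      moreover have "to_fract ([:l1:] * \<sigma>) \<noteq> 0" using l1 \<sigma> by simp
      ultimately show ?thesis by (simp only: proj_mat2_scale not_False_eq_True)
    qed
    also have "l2 / l1 = cis (Arg (l2 / l1))"
    proof -
      have "l2 = cnj l1" by (simp add: l1_def l2_def)
      moreover have "l1 \<noteq> 0" by (simp add: l1_def complex_eq_iff)
      ultimately have "cmod (l2 / l1) = 1" "l2 / l1 \<noteq> 0" by (simp_all add: norm_divide)
      then show ?thesis using cis_Arg[of "l2 / l1"] by (simp add: sgn_eq)
    qed
    finally show ?thesis by (simp only: R_rot_conv)
  qed
  ultimately show ?thesis by blast
qed

theorem lemma5p35:
  fixes A :: "(Cz_field^2^2) set" and n :: nat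
  assumes "A \<in> H_group"
    and "group.ord PGL2 A = n" and "n > 0" and "n \<noteq> 2"
  shows "\<exists>\<theta>::real. R_rot \<theta> \<in> H_group \<and>
           (\<exists>B\<in>H_group. B \<otimes>\<^bsub>PGL2\<^esub> A \<otimes>\<^bsub>PGL2\<^esub> inv\<^bsub>PGL2\<^esub> B = R_rot \<theta>)"
proof -
  interpret PGL: group "PGL2 :: (Cz_field^2^2) set monoid" by (rule group_PGL2)
  have A: "A \<in> carrier PGL2" using assms(1) by (simp add: H_group_def)
  have pow: "A [^]\<^bsub>PGL2\<^esub> n = \<one>\<^bsub>PGL2\<^esub>" using PGL.pow_ord_eq_1[OF A] assms(2) by simp
  have R0: "R_rot 0 = \<one>\<^bsub>PGL2\<^esub>"
    by (simp add: R_rot_conv one_PGL2 mat_mat2 Cz_const_conv flip: one_pCons)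
  show ?thesis
  proof (cases "A \<otimes>\<^bsub>PGL2\<^esub> A = \<one>\<^bsub>PGL2\<^esub>")
    case True
    then have "A [^]\<^bsub>PGL2\<^esub> (2::nat) = \<one>\<^bsub>PGL2\<^esub>" using A by (simp add: numeral_2_eq_2)
    then have "n dvd 2" using PGL.pow_eq_id[OF A] assms(2) by simp
    then have "n = 1" using assms(3,4) dvd_imp_le[of n 2] by fastforce
    then have "A = \<one>\<^bsub>PGL2\<^esub>" using pow A by simp
    then show ?thesis using R_rot_in_H[of 0] R0 by (intro exI[of _ 0] conjI bexI[of _ "R_rot 0"]) simp_all
  next
    case False
    obtain F a c where F: "F \<in> Aut_S_pi" "psi_conj F = moebius (unitary a c)"
      "A = proj (unitary a c)" "a \<noteq> 0" "no_common_real_root a c"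
      by (rule H_group_normal_form[OF assms(1)]) (use False in blast, rule that)
    obtain m where "n = Suc m" using assms(3) gr0_conv_Suc by blast
    then obtain y :: real where y: "y \<noteq> 0"
      "a * pbar a - hpoly * c * pbar c = [:of_real (1/4 + y\<^sup>2):] * (a + pbar a)\<^sup>2"
      using unitary_finite_order[OF F(3) A _ False] pow by blast
    have "nonvanishing_on {-1<..<1} a c" by (rule nonvanishing_interior[OF F(1,2,4,5)])
    from conjugate_to_rotation[OF F(3) y this F(5)] show ?thesis using R_rot_in_H by blast
  qed
qed

end
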